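(* Suppose $\phi$ is a conformal map of a Jordan domain $D$ onto the unit disk, and extend $\phi$ to $\overline{D}$ by letting, for each $\zeta\in\partial D$, $\phi(\zeta)$ be the unique point of $\bigcap_{r>0}\overline{\phi[C(D;\zeta,r)]}$. Let $\zeta_0$ be a boundary point of $D$. Then $\lim_{z\to\zeta_0}\phi(z)=\phi(\zeta_0)$. Furthermore, if $g$ is a modulus of local connectivity for the boundary of $D$, then for each $\epsilon>0$, $|\phi(z_0)-\phi(\zeta_0)|<\epsilon$ whenever $z_0$ is a point in $D$ such that $|z_0-\zeta_0|<2^{-g(k)}$ and $k$ is a non-negative integer such that $2^{-k}+2^{-g(k)}$ is smaller than $$\sup_{0<l<\epsilon}\left(\exp\left(\frac{8\pi^2}{l^2-\epsilon^2}\right)\min\left\{|\zeta_0-\phi^{-1}(w)|\ :\ |w|\le\sqrt{(1-l)^2+\frac{\epsilon^2-l^2}{4}}\right\}\right).$$ Finally, the extension of $\phi$ to $\overline{D}$ is a homeomorphism of $\overline{D}$ with the closed unit disk.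
   Context: A Jordan domain here is the interior (bounded complementary component) of a Jordan curve in $\mathbb{C}$. A conformal map of $D$ onto the unit disk is a holomorphic bijection from $D$ onto $\{w\in\mathbb{C}: |w|<1\}$. $D_r(\zeta)$ denotes the open disk with center $\zeta$ and radius $r$, and $\phi[X]$ denotes the image of $X$ under $\phi$. For $\zeta\in\partial D$ and $r>0$, $\zeta$ is a boundary point of exactly one connected component of $D_r(\zeta)\cap D$; this component is denoted $C(D;\zeta,r)$. The set $\bigcap_{r>0}\overline{\phi[C(D;\zeta,r)]}$ consists of exactly one point, which is how $\phi(\zeta)$ is defined. The limit $\lim_{z\to\zeta_0}\phi(z)$ is taken over $z\in D$. Let $\mathbb{N}$ be the set of non-negative integers. A modulus of local connectivity for a metric space $X$ with metric $d$ is a function $g:\mathbb{N}\to\mathbb{N}$ such that whenever $k\in\mathbb{N}$, $p,q\in X$ and $0<d(p,q)\le 2^{-g(k)}$, $X$ includes an arc from $p$ to $q$ whose diameter is smaller than $2^{-k}$. The boundary of $D$ carries the Euclidean metric. In the displayed expression $w$ ranges over points of the open unit disk (the domain of $\phi^{-1}:\{|w|<1\}\to D$) satisfying the stated bound; if the bound is at least $1$, the minimum is read as an infimum. *)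

theory Defs
  imports "HOL-Complex_Analysis.Complex_Analysis"
begin

definition jordan_domain :: "complex set \<Rightarrow> bool" where
  "jordan_domain D \<longleftrightarrow>
     (\<exists>c. simple_path c \<and> pathfinish c = pathstart c \<and>
          D \<in> components (- path_image c) \<and> bounded D)"

definition conformal_onto_disk :: "(complex \<Rightarrow> complex) \<Rightarrow> complex set \<Rightarrow> bool" where
  "conformal_onto_disk \<phi> D \<longleftrightarrow> \<phi> holomorphic_on D \<and> bij_betw \<phi> D (ball 0 1)"

(* The set C(D; \<zeta>, r). The description is meaningful for a boundary point \<zeta> of a
   Jordan domain D and r > 0, where exactly one component has \<zeta> on its boundary. *)
definition boundary_comp :: "complex set \<Rightarrow> complex \<Rightarrow> real \<Rightarrow> complex set" where
  "boundary_comp D \<zeta> r =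
     (THE C. C \<in> components (ball \<zeta> r \<inter> D) \<and> \<zeta> \<in> frontier C)"

(* The extension of \<phi> from the open set D to its closure; values off the closure
   are irrelevant. *)
definition boundary_ext :: "(complex \<Rightarrow> complex) \<Rightarrow> complex set \<Rightarrow> complex \<Rightarrow> complex" where
  "boundary_ext \<phi> D \<zeta> =
     (if \<zeta> \<in> frontier D
      then (THE w. w \<in> (\<Inter>r\<in>{0<..}. closure (\<phi> ` boundary_comp D \<zeta> r)))
      else \<phi> \<zeta>)"

definition local_connectivity_modulus :: "'a::metric_space set \<Rightarrow> (nat \<Rightarrow> nat) \<Rightarrow> bool" where
  "local_connectivity_modulus X g \<longleftrightarrow>
     (\<forall>k. \<forall>p\<in>X. \<forall>q\<in>X. 0 < dist p q \<and> dist p q \<le> 1 / 2 ^ g k \<longrightarrow>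
        (\<exists>\<gamma>. arc \<gamma> \<and> path_image \<gamma> \<subseteq> X \<and> pathstart \<gamma> = p \<and> pathfinish \<gamma> = q \<and>
             diameter (path_image \<gamma>) < 1 / 2 ^ k))"

(* The infimum is a minimum when the bound on |w| is less than 1. The point w = 0 always
   satisfies that bound, and the exponential factor is less than 1, so all infima and
   the supremum are over nonempty sets of reals bounded on the relevant side. *)
definition closeness_bound :: "(complex \<Rightarrow> complex) \<Rightarrow> complex set \<Rightarrow> complex \<Rightarrow> real \<Rightarrow> real" where
  "closeness_bound \<phi> D \<zeta>0 \<epsilon> =
     (SUP l\<in>{0<..<\<epsilon>}.
        exp (8 * pi\<^sup>2 / (l\<^sup>2 - \<epsilon>\<^sup>2)) *
        (INF w\<in>{w. norm w < 1 \<and> norm w \<le> sqrt ((1 - l)\<^sup>2 + (\<epsilon>\<^sup>2 - l\<^sup>2) / 4)}.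
           norm (\<zeta>0 - inv_into D \<phi> w)))"

end

theory Submission
  imports Defs
begin

text \<open>
  The proof rests on two tools.

  The first is the length-area principle (\<open>length_area\<close>): an injective holomorphic map with bounded
  image takes some circle in any sufficiently thick annulus to a set all of whose connected pieces have
  small diameter. It is applied to \<open>\<phi>\<close> on circles around a boundary point, and to its inverse \<open>\<psi>\<close> on
  circles around a point of the unit circle.

  The second is Janiszewski's theorem, which controls connectedness near a Jordan curve. It yields
  local connectedness of the domain at its boundary
  (\<open>jordan_domain_locally_connected_at_frontier\<close>), hence the component \<open>C(D; \<zeta>, r)\<close> is well defined, contains
  all points of the domain near \<open>\<zeta>\<close>, and does not change when \<open>\<zeta>\<close> moves along a boundary arc within
  the disk. The last property turns a modulus of local connectivity into an explicit radius
  (\<open>modulus_imp_in_boundary_comp\<close>).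

  Let \<open>m = \<bar>\<zeta> - \<psi> 0\<bar>\<close>. If \<open>ln (m / r1) > 2 \<pi>\<^sup>2 / B\<^sup>2\<close> and \<open>B < 1\<close>, there is a radius between \<open>r1\<close> and \<open>m\<close> for
  which one arc of the circle around \<open>\<zeta>\<close> separates \<open>C(D; \<zeta>, r)\<close> from \<open>\<psi> 0\<close> in the domain, and has an image of
  diameter at most \<open>B\<close> that reaches the unit circle. Hence \<open>\<phi>\<close> maps the component into a disk of
  radius \<open>B\<close> (\<open>crosscut_estimate\<close>). Letting \<open>B\<close> tend to 0 gives the limit of \<open>\<phi>\<close> at \<open>\<zeta>\<close>. Taking \<open>B\<close> slightly below
  \<open>\<epsilon> / 2\<close> gives the explicit estimate, whose constant arises as \<open>8 \<pi>\<^sup>2 / \<epsilon>\<^sup>2 = 2 \<pi>\<^sup>2 / (\<epsilon> / 2)\<^sup>2\<close>.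

  The extension is continuous on the compact closure, because it is given by limits of \<open>\<phi>\<close>, and it sends
  boundary points to the unit circle. For injectivity on the boundary, the \<open>\<psi>\<close>-images of small
  circles around a point of the unit circle shrink to a single boundary point, and Janiszewski's theorem
  shows that no other boundary point can have the same value (\<open>ext_frontier_unique\<close>).
\<close>

unbundle no fps_syntax

section \<open>The area of a conformal image in Cartesian coordinates\<close>

text \<open>
  Jacobian determinants are taken of matrices acting on \<^typ>\<open>real^2\<close>, whereas iterated integrals run
  over pairs of reals. The isometry with \<^typ>\<open>complex\<close> below links the two.
\<close>

definition vec2_of_complex :: "complex \<Rightarrow> real^2" where
  "vec2_of_complex z = (\<chi> i. if i = 1 then Re z else Im z)"

definition complex_of_vec2 :: "real^2 \<Rightarrow> complex" where
  "complex_of_vec2 p = Complex (p $ 1) (p $ 2)"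

lemma vec2_of_complex_nth [simp]:
  "vec2_of_complex z $ 1 = Re z" "vec2_of_complex z $ 2 = Im z"
  by (auto simp: vec2_of_complex_def)

lemma complex_of_vec2_inverse [simp]: "vec2_of_complex (complex_of_vec2 p) = p"
  by (simp add: vec_eq_iff forall_2 complex_of_vec2_def)

lemma vec2_of_complex_inverse [simp]: "complex_of_vec2 (vec2_of_complex z) = z"
  by (simp add: complex_of_vec2_def)

lemma bounded_linear_vec2_of_complex: "bounded_linear vec2_of_complex"
  by (auto intro!: linear_conv_bounded_linear[THEN iffD1] linearI simp: vec_eq_iff forall_2)

lemma bounded_linear_complex_of_vec2: "bounded_linear complex_of_vec2"
  by (auto intro!: linear_conv_bounded_linear[THEN iffD1] linearI
           simp: complex_of_vec2_def complex_eq_iff)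

lemma norm_vec2_of_complex [simp]: "norm (vec2_of_complex z) = norm z"
  by (simp add: norm_vec_def L2_set_def sum_2 cmod_def)

lemma lborel_vec2:
  "lborel = distr (lborel \<Otimes>\<^sub>M lborel) borel (\<lambda>(x, y). vec2_of_complex (Complex x y))"
proof (rule lborel_eqI)
  let ?T = "\<lambda>(x, y). vec2_of_complex (Complex x y)"
  have "continuous_on UNIV ?T"
    unfolding case_prod_beta Complex_eq
    by (intro bounded_linear.continuous_on[OF bounded_linear_vec2_of_complex] continuous_intros)
  then have T: "?T \<in> borel_measurable (lborel \<Otimes>\<^sub>M lborel)"
    using borel_measurable_continuous_onI by (simp add: borel_prod lborel_prod)
  fix l u :: "real^2" assume le: "\<And>b. b \<in> Basis \<Longrightarrow> l \<bullet> b \<le> u \<bullet> b"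
  have le': "l $ i \<le> u $ i" for i
    using le[of "axis i 1"] by (simp add: inner_axis)
  have "?T -` box l u = box (l $ 1) (u $ 1) \<times> box (l $ 2) (u $ 2)"
    by (auto simp: mem_box_cart forall_2)
  then have "emeasure (distr (lborel \<Otimes>\<^sub>M lborel) borel ?T) (box l u)
     = emeasure (lborel \<Otimes>\<^sub>M lborel) (box (l $ 1) (u $ 1) \<times> box (l $ 2) (u $ 2))"
    using T by (simp add: emeasure_distr space_pair_measure)
  also have "\<dots> = ennreal ((u $ 1 - l $ 1) * (u $ 2 - l $ 2))"
    using le' by (subst lborel.emeasure_pair_measure_Times) (auto simp: ennreal_mult)
  also have "(u $ 1 - l $ 1) * (u $ 2 - l $ 2) = (\<Prod>b\<in>Basis. (u - l) \<bullet> b)"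
  proof -
    have B: "(Basis :: (real^2) set) = {axis 1 1, axis 2 1}"
      by (auto simp: Basis_vec_def UNIV_2)
    have "axis 1 1 \<noteq> (axis 2 1 :: real^2)" by (simp add: axis_eq_axis)
    then show ?thesis by (simp add: B inner_axis)
  qed
  finally show "emeasure (distr (lborel \<Otimes>\<^sub>M lborel) borel ?T) (box l u) = ennreal (\<Prod>b\<in>Basis. (u - l) \<bullet> b)" .
qed simp

text \<open>
  The Jacobian determinant of a holomorphic \<^term>\<open>f\<close> is \<open>\<bar>f'\<bar>\<^sup>2\<close>, so for injective \<^term>\<open>f\<close> the integral
  on the left is the area of the image, which lies in a disk of area \<open>\<pi> M\<^sup>2\<close>.
\<close>

lemma integral_norm_deriv_sq_le_area:
  assumes "open E" "f holomorphic_on E" "inj_on f E" "f ` E \<subseteq> ball 0 M"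
  shows "(\<integral>\<^sup>+x. \<integral>\<^sup>+y. indicator E (Complex x y) * ennreal ((norm (deriv f (Complex x y)))\<^sup>2) \<partial>lborel \<partial>lborel)
     \<le> ennreal (pi * M\<^sup>2)"
proof (cases "E = {}")
  case True
  then show ?thesis by simp
next
  case False
  then have M: "M > 0" using assms(4) by (metis ball_eq_empty image_is_empty leI subset_empty)
  define S where "S = complex_of_vec2 -` E"
  define F where "F = vec2_of_complex \<circ> f \<circ> complex_of_vec2"
  define F' where "F' = (\<lambda>p. vec2_of_complex \<circ> (\<lambda>h. deriv f (complex_of_vec2 p) * h) \<circ> complex_of_vec2)"
  have "open S" unfolding S_def
    by (intro open_vimage assms linear_continuous_on bounded_linear_complex_of_vec2)
  have FS: "F ` S = complex_of_vec2 -` (f ` E)"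
  proof (intro equalityI subsetI)
    fix p assume "p \<in> complex_of_vec2 -` (f ` E)"
    then obtain z where z: "z \<in> E" "complex_of_vec2 p = f z" by auto
    then have "p = F (vec2_of_complex z)"
      by (metis F_def comp_apply complex_of_vec2_inverse vec2_of_complex_inverse)
    then show "p \<in> F ` S" using z by (simp add: S_def)
  qed (auto simp: F_def S_def)
  have opF: "open (F ` S)" unfolding FS
    by (intro open_vimage linear_continuous_on bounded_linear_complex_of_vec2 open_mapping_thm3 assms)
  have subF: "F ` S \<subseteq> ball 0 M"
    using assms(4) by (auto simp: F_def S_def)
  have detF: "det (matrix (F' p)) = (norm (deriv f (complex_of_vec2 p)))\<^sup>2" for p
    by (simp add: det_2 matrix_def F'_def complex_of_vec2_def axis_def cmod_power2 power2_eq_square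
        flip: power2_eq_square)
  have der: "(F has_derivative F' p) (at p within S)" if "p \<in> S" for p
  proof -
    have "(f has_field_derivative deriv f (complex_of_vec2 p)) (at (complex_of_vec2 p))"
      using that assms holomorphic_derivI S_def by blast
    then have "(f has_derivative (\<lambda>h. deriv f (complex_of_vec2 p) * h)) (at (complex_of_vec2 p))"
      by (simp add: has_field_derivative_def)
    moreover have "(complex_of_vec2 has_derivative complex_of_vec2) (at p within S)"
       by (rule bounded_linear.has_derivative[OF bounded_linear_complex_of_vec2 has_derivative_ident])
    ultimately have "(f \<circ> complex_of_vec2 has_derivative (\<lambda>h. deriv f (complex_of_vec2 p) * h) \<circ> complex_of_vec2) (at p within S)"
      by (metis diff_chain_within has_derivative_at_withinI)
    then show ?thesis unfolding F_def F'_def o_def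
      by (rule bounded_linear.has_derivative[OF bounded_linear_vec2_of_complex])
  qed
  have injF: "inj_on F S"
    unfolding F_def S_def inj_on_def
    using assms(3) by (metis comp_apply complex_of_vec2_inverse inj_onD vec2_of_complex_inverse vimage_eq)
  have "F ` S \<in> lmeasurable"
    by (meson opF subF bounded_ball bounded_subset lmeasurable_open)
  then have hi: "((\<lambda>x. \<bar>det (matrix (F' x))\<bar>) has_integral measure lebesgue (F ` S)) S"
    using has_measure_differentiable_image[OF _ der injF] \<open>open S\<close> by auto
  have ml: "measure lebesgue (F ` S) \<le> pi * M\<^sup>2"
  proof -
    have "measure lebesgue (F ` S) \<le> measure lebesgue (ball 0 M :: (real^2) set)"
      by (rule measure_mono_fmeasurable[OF subF]) (auto simp: opF)
    also have "\<dots> = pi * M\<^sup>2"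
      using circle_area[of M 0] M by simp
    finally show ?thesis .
  qed
  define G where "G = (\<lambda>z. indicator E z * (norm (deriv f z))\<^sup>2)"
  have Gm: "G \<in> borel_measurable borel"
  proof -
    have "(\<lambda>z. indicator E z *\<^sub>R (norm (deriv f z))\<^sup>2) \<in> borel_measurable borel"
      by (intro borel_measurable_continuous_on_indicator continuous_intros holomorphic_on_imp_continuous_on holomorphic_deriv assms) (simp add: assms)
    then show ?thesis by (simp add: G_def)
  qed
  have cm[measurable]: "complex_of_vec2 \<in> borel_measurable borel"
    by (intro borel_measurable_continuous_onI linear_continuous_on bounded_linear_complex_of_vec2)
  have G2: "(\<lambda>p. G (complex_of_vec2 p)) \<in> borel_measurable borel"
    by (rule measurable_compose[OF cm Gm])
  have "((\<lambda>x. if x \<in> S then \<bar>det (matrix (F' x))\<bar> else 0) has_integral measure lebesgue (F ` S)) UNIV"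
    using hi by (simp only: has_integral_restrict_UNIV)
  also have "(\<lambda>x. if x \<in> S then \<bar>det (matrix (F' x))\<bar> else 0) = (\<lambda>p. G (complex_of_vec2 p))"
    by (auto simp: G_def detF S_def fun_eq_iff)
  finally have hG: "((\<lambda>p. G (complex_of_vec2 p)) has_integral measure lebesgue (F ` S)) UNIV" .
  have "integral\<^sup>N lborel (\<lambda>p. ennreal (G (complex_of_vec2 p))) = ennreal (measure lebesgue (F ` S))"
    by (rule nn_integral_has_integral_lborel[OF G2 _ hG]) (simp add: G_def)
  then have "integral\<^sup>N lborel (\<lambda>p. ennreal (G (complex_of_vec2 p))) \<le> ennreal (pi * M\<^sup>2)"
    using ml by (auto intro: ennreal_leI)
  also have "integral\<^sup>N lborel (\<lambda>p. ennreal (G (complex_of_vec2 p))) =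
     (\<integral>\<^sup>+q. ennreal (G (case q of (x, y) \<Rightarrow> Complex x y)) \<partial>(lborel \<Otimes>\<^sub>M lborel))"
  proof -
    have "continuous_on UNIV (\<lambda>(x, y). vec2_of_complex (Complex x y))"
      unfolding case_prod_beta Complex_eq
      by (intro bounded_linear.continuous_on[OF bounded_linear_vec2_of_complex] continuous_intros)
    then have T: "(\<lambda>(x, y). vec2_of_complex (Complex x y)) \<in> borel_measurable (lborel \<Otimes>\<^sub>M lborel)"
      using borel_measurable_continuous_onI by (simp add: borel_prod lborel_prod)
    show ?thesis
      by (subst lborel_vec2, subst nn_integral_distr[OF T])
         (use G2 in \<open>auto intro!: nn_integral_cong\<close>)
  qed
  also have "\<dots> = (\<integral>\<^sup>+x. \<integral>\<^sup>+y. ennreal (G (Complex x y)) \<partial>lborel \<partial>lborel)"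
  proof -
    have "continuous_on UNIV (\<lambda>(x, y). Complex x y)"
      unfolding case_prod_beta Complex_eq  by (intro continuous_intros)
    then have [measurable]: "(\<lambda>(x, y). Complex x y) \<in> borel_measurable (lborel \<Otimes>\<^sub>M lborel)"
      using borel_measurable_continuous_onI by (simp add: borel_prod lborel_prod)
    note Gm[measurable]
    have "(\<lambda>q. ennreal (G (case q of (x, y) \<Rightarrow> Complex x y))) \<in> borel_measurable (lborel \<Otimes>\<^sub>M lborel)"
      by measurable
    from lborel.nn_integral_fst[OF this] show ?thesis by simp
  qed
  also have "\<dots> = (\<integral>\<^sup>+x. \<integral>\<^sup>+y. indicator E (Complex x y) * ennreal ((norm (deriv f (Complex x y)))\<^sup>2) \<partial>lborel \<partial>lborel)"
    by (auto intro!: nn_integral_cong simp: G_def indicator_def)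
  finally show ?thesis .
qed

section \<open>The length-area principle\<close>

text \<open>
  A connected part of a circle contains one of the two arcs between any two of its points: a proper
  part omits a point, and removing that point turns the circle into an interval.
\<close>

lemma connected_subset_circle_arc:
  fixes K :: "complex set"
  assumes "connected K" "K \<subseteq> sphere c r" "r > 0" "x \<in> K" "y \<in> K"
  obtains \<alpha> \<beta> where "\<alpha> \<le> \<beta>" "\<beta> \<le> \<alpha> + 2 * pi"
    "{x, y} = {c + of_real r * exp (\<i> * of_real \<alpha>), c + of_real r * exp (\<i> * of_real \<beta>)}"
    "\<And>t. \<alpha> \<le> t \<Longrightarrow> t \<le> \<beta> \<Longrightarrow> c + of_real r * exp (\<i> * of_real t) \<in> K"
proof -
  let ?e = "\<lambda>t. c + of_real r * exp (\<i> * of_real t)"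
  show thesis
  proof (cases "K = sphere c r")
    case True
    have *: "?e (Arg (z - c)) = z" "- pi < Arg (z - c)" "Arg (z - c) \<le> pi" if "z \<in> K" for z
    proof -
      have "norm (z - c) = r" using that assms(2) by (auto simp: dist_norm norm_minus_commute)
      then show "?e (Arg (z - c)) = z"
        using Arg_eq[of "z - c"] assms(3) by auto
    qed (use Arg_bounded in auto)
    have mem: "?e t \<in> K" for t using True assms(3) by (simp add: dist_norm norm_mult)
    show thesis
    proof (cases "Arg (x - c) \<le> Arg (y - c)")
      case True
      then show thesis
        using that[of "Arg (x - c)" "Arg (y - c)"] *[OF assms(4)] *[OF assms(5)] mem by auto
    next
      case False
      then show thesis
        using that[of "Arg (y - c)" "Arg (x - c)"] *[OF assms(4)] *[OF assms(5)] mem by auto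
    qed
  next
    case False
    then obtain p where p: "p \<in> sphere c r" "p \<notin> K" using assms(2) by blast
    define u where "u = c - p"
    define T where "T = (\<lambda>z. Arg u + Arg ((z - c) / u))"
    have u: "norm u = r" using p by (simp add: u_def dist_norm)
    then have u0: "u \<noteq> 0" using assms(3) by auto
    have eT: "?e (T z) = z" if "z \<in> K" for z
    proof -
      have "norm (z - c) = r" using that assms(2) by (auto simp: dist_norm norm_minus_commute)
      then have n: "norm ((z - c) / u) = 1" using u assms(3) by (simp add: norm_divide)
      then have "(z - c) / u \<noteq> 0" by force
      then have "(z - c) / u = exp (\<i> * Arg ((z - c) / u))"
        using Arg_eq[of "(z - c) / u"] n by simp
      moreover have "u = of_real r * exp (\<i> * Arg u)" using Arg_eq[of u] u u0 by auto
      ultimately have "of_real r * exp (\<i> * T z) = u * ((z - c) / u)"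
        by (simp add: T_def ring_distribs exp_add mult_ac)
      then show ?thesis using u0 by simp
    qed
    have "continuous_on K T" unfolding T_def
    proof (rule continuous_on_add[OF continuous_on_const])
      show "continuous_on K (\<lambda>z. Arg ((z - c) / u))"
      proof (rule continuous_on_Arg')
        fix z assume z: "z \<in> K"
        have "norm (z - c) = r" using z assms(2) by (auto simp: dist_norm norm_minus_commute)
        then have n: "norm ((z - c) / u) = 1" using u assms(3) by (simp add: norm_divide)
        have "(z - c) / u \<noteq> -1"
        proof
          assume "(z - c) / u = -1"
          then have "z - c = - u" using u0 by (simp add: field_simps)
          then show False using z p by (simp add: u_def)
        qed
        moreover have "w = -1" if "norm w = 1" "w \<in> \<real>\<^sub>\<le>\<^sub>0" for w :: complex
          using that by (auto simp: complex_nonpos_Reals_iff complex_eq_iff cmod_def power2_eq_1_iff)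
        ultimately show "(z - c) / u \<notin> \<real>\<^sub>\<le>\<^sub>0" using n by blast
      qed (use u0 in \<open>auto intro!: continuous_intros\<close>)
    qed
    then have "is_interval (T ` K)"
      using connected_continuous_image[OF _ assms(1)] is_interval_connected_1 by blast
    then have TK: "t \<in> T ` K" if "T a \<le> t" "t \<le> T b" "a \<in> K" "b \<in> K" for a b t
      using that unfolding is_interval_1 by blast
    have mem: "?e t \<in> K" if "T a \<le> t" "t \<le> T b" "a \<in> K" "b \<in> K" for a b t
      using TK[OF that] eT by force
    have bd: "T a \<le> T b + 2 * pi" for a b
      using Arg_bounded[of "(a - c) / u"] Arg_bounded[of "(b - c) / u"] by (simp add: T_def)
    show thesis
    proof (cases "T x \<le> T y")
      case True
      then show thesis
        using that[of "T x" "T y"] eT assms(4,5) mem[of x _ y] bd by auto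
    next
      case False
      then show thesis
        using that[of "T y" "T x"] eT assms(4,5) mem[of y _ x] bd by auto
    qed
  qed
qed

lemma inj_on_exp_period_strip: "inj_on exp {s::complex. 0 < Im s \<and> Im s < 2 * pi}"
proof (rule inj_onI)
  fix s t :: complex assume *: "s \<in> {s. 0 < Im s \<and> Im s < 2 * pi}" "t \<in> {s. 0 < Im s \<and> Im s < 2 * pi}" "exp s = exp t"
  then obtain n :: int where n: "s = t + of_int (2 * n) * pi * \<i>"
    by (auto simp: exp_eq)
  then have "Im s = Im t + 2 * n * pi" by simp
  with * have "\<bar>2 * real_of_int n * pi\<bar> < 2 * pi" by auto
  then have "n = 0" by (simp add: abs_mult)
  then show "s = t" using n by simp
qed

text \<open>
  An interval of length at most one period may straddle a multiple of \<open>2\<pi>\<close>; shifting the excess back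
  by one period makes its two parts almost disjoint inside the standard period. This lets an arc of a
  circle cross the ray along which polar coordinates are cut.
\<close>

lemma nn_integral_periodic_le:
  fixes F :: "real \<Rightarrow> ennreal"
  assumes [measurable]: "F \<in> borel_measurable borel" and per: "\<And>y. F (y + 2 * pi) = F y"
    and "0 \<le> \<alpha>" "\<alpha> < 2 * pi" "\<alpha> \<le> \<beta>" "\<beta> \<le> \<alpha> + 2 * pi"
  shows "(\<integral>\<^sup>+y. indicator {\<alpha>..\<beta>} y * F y \<partial>lborel) \<le> (\<integral>\<^sup>+y. indicator {0<..<2*pi} y * F y \<partial>lborel)"
proof -
  have "(\<integral>\<^sup>+y. indicator {\<alpha>..\<beta>} y * F y \<partial>lborel)
     \<le> (\<integral>\<^sup>+y. indicator {\<alpha>..<2*pi} y * F y + indicator {2*pi..\<beta>} y * F y \<partial>lborel)"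
    by (intro nn_integral_mono) (auto simp: indicator_def)
  also have "\<dots> = (\<integral>\<^sup>+y. indicator {\<alpha>..<2*pi} y * F y \<partial>lborel) + (\<integral>\<^sup>+y. indicator {2*pi..\<beta>} y * F y \<partial>lborel)"
    by (rule nn_integral_add) measurable
  also have "(\<integral>\<^sup>+y. indicator {2*pi..\<beta>} y * F y \<partial>lborel) = (\<integral>\<^sup>+y. indicator {0..\<beta>-2*pi} y * F y \<partial>lborel)"
  proof -
    have "(\<integral>\<^sup>+y. indicator {2*pi..\<beta>} y * F y \<partial>lborel)
      = (\<integral>\<^sup>+y. indicator {2*pi..\<beta>} (2 * pi + 1 * y) * F (2 * pi + 1 * y) \<partial>lborel)"
      by (subst nn_integral_real_affine[where c=1 and t="2*pi"]) auto
    also have "\<dots> = (\<integral>\<^sup>+y. indicator {0..\<beta>-2*pi} y * F y \<partial>lborel)"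
      using per by (intro nn_integral_cong) (auto simp: indicator_def add.commute)
    finally show ?thesis .
  qed
  also have "(\<integral>\<^sup>+y. indicator {\<alpha>..<2*pi} y * F y \<partial>lborel) + (\<integral>\<^sup>+y. indicator {0..\<beta>-2*pi} y * F y \<partial>lborel)
    = (\<integral>\<^sup>+y. indicator {\<alpha>..<2*pi} y * F y + indicator {0..\<beta>-2*pi} y * F y \<partial>lborel)"
    by (rule nn_integral_add[symmetric]) measurable
  also have "\<dots> \<le> (\<integral>\<^sup>+y. indicator {0<..<2*pi} y * F y \<partial>lborel)"
  proof (rule nn_integral_mono_AE)
    have "AE y in lborel. y \<notin> {0, \<alpha>, \<beta> - 2 * pi}"
      by (intro AE_not_in finite_imp_null_set_lborel) auto
    then show "AE y in lborel. indicator {\<alpha>..<2*pi} y * F y + indicator {0..\<beta>-2*pi} y * F y \<le> indicator {0<..<2*pi} y * F y"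
      by eventually_elim (use assms in \<open>auto simp: indicator_def\<close>)
  qed
  finally show ?thesis .
qed


text \<open>
  In logarithmic polar coordinates \<open>s = x + i y\<close>, \<open>z = c + e\<^sup>s\<close>, the annulus becomes a rectangle of width
  \<open>ln (r2 / r1)\<close> and height \<open>2\<pi>\<close>, and the circle of radius \<open>e\<^sup>x\<close> becomes a vertical segment. The area of
  the image is at most \<open>\<pi> M\<^sup>2\<close>, so on some vertical segment the integral of \<open>\<bar>g'\<bar>\<^sup>2\<close> is at most any
  \<open>\<kappa> > \<pi> M\<^sup>2 / ln (r2 / r1)\<close>. By Cauchy-Schwarz the image of that segment has length at most
  \<open>sqrt (2\<pi> \<kappa>)\<close>, and \<open>\<kappa>\<close> is chosen so that this is \<^term>\<open>B\<close>.
\<close>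

lemma length_area:
  assumes "open U" "f holomorphic_on U" "inj_on f U" "f ` U \<subseteq> ball 0 M"
    and "0 < r1" "r1 < r2" "0 < B" "2 * pi\<^sup>2 * M\<^sup>2 < B\<^sup>2 * ln (r2 / r1)"
  obtains r where "r1 < r" "r < r2"
    "\<And>K x y. connected K \<Longrightarrow> K \<subseteq> sphere c r \<inter> U \<Longrightarrow> x \<in> K \<Longrightarrow> y \<in> K \<Longrightarrow> dist (f x) (f y) \<le> B"
proof -
  define P where "P = (\<lambda>s. c + exp s :: complex)"
  define g where "g = f \<circ> P"
  define W where "W = P -` U"
  define a b where "a = ln r1" and "b = ln r2"
  define E where "E = W \<inter> {s. a < Re s} \<inter> {s. Re s < b} \<inter> {s. 0 < Im s} \<inter> {s. Im s < 2 * pi}"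
  define \<kappa> where "\<kappa> = B\<^sup>2 / (2 * pi)"
  have ab: "a < b" using assms by (simp add: a_def b_def)
  have holP: "P holomorphic_on A" for A unfolding P_def by (intro holomorphic_intros)
  have opW: "open W" unfolding W_def
    by (intro open_vimage assms holomorphic_on_imp_continuous_on holP)
  have holg: "g holomorphic_on W" unfolding g_def
    by (rule holomorphic_on_compose_gen[OF holP assms(2)]) (auto simp: W_def)
  have opE: "open E" unfolding E_def
    by (intro open_Int opW open_halfspace_Re_gt open_halfspace_Re_lt open_halfspace_Im_gt open_halfspace_Im_lt)
  have injg: "inj_on g E"
  proof (rule inj_onI)
    fix s t assume st: "s \<in> E" "t \<in> E" "g s = g t"
    then have "P s = P t"
      by - (rule inj_onD[OF assms(3)], simp_all add: g_def E_def W_def)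
    then show "s = t" using st
      by - (rule inj_onD[OF inj_on_exp_period_strip], simp_all add: P_def E_def)
  qed
  have area: "(\<integral>\<^sup>+x. \<integral>\<^sup>+y. indicator E (Complex x y) * ennreal ((norm (deriv g (Complex x y)))\<^sup>2) \<partial>lborel \<partial>lborel)
     \<le> ennreal (pi * M\<^sup>2)"
    using assms(4) by (intro integral_norm_deriv_sq_le_area opE injg holomorphic_on_subset[OF holg])
      (auto simp: E_def W_def g_def)
  define h where "h = (\<lambda>x y. indicator W (Complex x y) * ennreal ((norm (deriv g (Complex x y)))\<^sup>2))"
  have "\<exists>x\<in>{a<..<b}. (\<integral>\<^sup>+y. indicator {0<..<2*pi} y * h x y \<partial>lborel) \<le> ennreal \<kappa>"
  proof (rule ccontr)
    assume neg: "\<not> ?thesis"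
    have "ennreal \<kappa> * indicator {a<..<b} x \<le> (\<integral>\<^sup>+y. indicator E (Complex x y) * ennreal ((norm (deriv g (Complex x y)))\<^sup>2) \<partial>lborel)" for x
    proof (cases "x \<in> {a<..<b}")
      case True
      with neg have "ennreal \<kappa> \<le> (\<integral>\<^sup>+y. indicator {0<..<2*pi} y * h x y \<partial>lborel)"
        by (meson linear)
      also have "\<dots> = (\<integral>\<^sup>+y. indicator E (Complex x y) * ennreal ((norm (deriv g (Complex x y)))\<^sup>2) \<partial>lborel)"
        using True by (intro nn_integral_cong) (auto simp: h_def E_def indicator_def)
      finally show ?thesis using True by simp
    qed auto
    then have "(\<integral>\<^sup>+x. ennreal \<kappa> * indicator {a<..<b} x \<partial>lborel) \<le> ennreal (pi * M\<^sup>2)"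
      by (intro order_trans[OF nn_integral_mono area])
    also have "(\<integral>\<^sup>+x. ennreal \<kappa> * indicator {a<..<b} x \<partial>lborel) = ennreal (\<kappa> * (b - a))"
      using ab by (simp add: nn_integral_cmult_indicator \<kappa>_def flip: ennreal_mult)
    finally have "\<kappa> * (b - a) \<le> pi * M\<^sup>2"
      by (simp add: ennreal_le_iff)
    moreover have "b - a = ln (r2 / r1)" using assms by (simp add: a_def b_def ln_div)
    ultimately have "B\<^sup>2 * ln (r2 / r1) \<le> pi * M\<^sup>2 * (2 * pi)"
      by (simp add: \<kappa>_def field_simps)
    then show False using assms(8) by (simp add: power2_eq_square algebra_simps)
  qed
  then obtain x where x: "a < x" "x < b"
    and xk: "(\<integral>\<^sup>+y. indicator {0<..<2*pi} y * h x y \<partial>lborel) \<le> ennreal \<kappa>" by auto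
  \<comment> \<open>Cauchy-Schwarz enters through this pointwise inequality, tuned so that integrating it over a
      period with \<open>\<integral> u\<^sup>2 = \<kappa>\<close> gives exactly \<open>B\<close>.\<close>
  have pw: "2 * u \<le> B / (2 * pi) + u\<^sup>2 / (B / (2 * pi))" for u :: real
  proof -
    have l: "B / (2 * pi) > 0" (is "?l > 0") using assms by simp
    have "0 \<le> (u - ?l)\<^sup>2 / ?l" using l by (intro divide_nonneg_pos) auto
    also have "\<dots> = u\<^sup>2 / ?l - 2 * u + ?l" using l assms(7) by (simp add: power2_eq_square field_simps)
    finally show ?thesis by simp
  qed
  have cont: "continuous_on {\<alpha>..\<beta>} (\<lambda>y. deriv g (Complex x y))" if "\<And>t. \<alpha> \<le> t \<Longrightarrow> t \<le> \<beta> \<Longrightarrow> Complex x t \<in> W" for \<alpha> \<beta>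
    using that by (intro continuous_on_compose2[OF holomorphic_on_imp_continuous_on[OF holomorphic_deriv[OF holg opW]]])
       (auto simp: Complex_eq intro!: continuous_intros)
  have hm: "h x \<in> borel_measurable borel"
  proof -
    have "(\<lambda>z. indicator W z *\<^sub>R (norm (deriv g z))\<^sup>2) \<in> borel_measurable borel"
      by (intro borel_measurable_continuous_on_indicator continuous_intros holomorphic_on_imp_continuous_on holomorphic_deriv holg opW) (simp add: opW)
    moreover have "(\<lambda>y. Complex x y) \<in> borel_measurable borel"
      unfolding Complex_eq by measurable
    ultimately have [measurable]: "(\<lambda>y. indicator W (Complex x y) *\<^sub>R (norm (deriv g (Complex x y)))\<^sup>2) \<in> borel_measurable borel"
      using measurable_compose by blast
    have "(\<lambda>y. ennreal (indicator W (Complex x y) *\<^sub>R (norm (deriv g (Complex x y)))\<^sup>2)) \<in> borel_measurable borel"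
      by measurable
    also have "(\<lambda>y. ennreal (indicator W (Complex x y) *\<^sub>R (norm (deriv g (Complex x y)))\<^sup>2)) = h x"
      by (auto simp: h_def indicator_def)
    finally show ?thesis .
  qed
  have perP: "P (Complex x (y + 2 * pi)) = P (Complex x y)" for y
    by (simp add: P_def exp_eq_polar flip: cis_mult)
  have perW: "Complex x (y + 2 * pi) \<in> W \<longleftrightarrow> Complex x y \<in> W" for y
    by (simp add: W_def perP)
  have perg: "deriv g (Complex x (y + 2 * pi)) = deriv g (Complex x y)" for y
  proof -
    have "P (2 * pi * \<i> + s) = P s" for s by (simp add: P_def exp_add)
    then have "(\<lambda>w. g (2 * pi * \<i> + w)) = g" by (simp add: g_def fun_eq_iff)
    have "deriv (\<lambda>w. g (p + w)) q = deriv g (p + q)" for p q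
      by (simp only: deriv_shift_0[of _ q] deriv_shift_0[of _ "p + q"] o_def add.assoc)
    from this[of "2 * pi * \<i>" "Complex x y"] \<open>(\<lambda>w. g (2 * pi * \<i> + w)) = g\<close>
    have "deriv g (Complex x y) = deriv g (2 * pi * \<i> + Complex x y)"
      by (simp only:)
    moreover have "2 * pi * \<i> + Complex x y = Complex x (y + 2 * pi)"
      by (simp add: complex_eq_iff)
    ultimately show ?thesis by simp
  qed
  have perh: "h x (y + 2 * pi) = h x y" for y
    by (simp add: h_def perW perg indicator_def)
  \<comment> \<open>Lower end normalised to the standard period; the general case follows by a translation.\<close>
  have main0: "dist (g (Complex x \<alpha>)) (g (Complex x \<beta>)) \<le> B" if W: "\<And>t. \<alpha> \<le> t \<Longrightarrow> t \<le> \<beta> \<Longrightarrow> Complex x t \<in> W"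
    and ab': "0 \<le> \<alpha>" "\<alpha> < 2 * pi" "\<alpha> \<le> \<beta>" "\<beta> \<le> \<alpha> + 2 * pi" for \<alpha> \<beta>
  proof -
    let ?d = "\<lambda>y. deriv g (Complex x y)"
    have c: "continuous_on {\<alpha>..\<beta>} ?d" using cont[of \<alpha> \<beta>] W by blast
    have "((\<lambda>y. ?d y * \<i>) has_integral (g (Complex x \<beta>) - g (Complex x \<alpha>))) {\<alpha>..\<beta>}"
    proof (rule fundamental_theorem_of_calculus)
      fix y assume y: "y \<in> {\<alpha>..\<beta>}"
      have "(g has_field_derivative ?d y) (at (Complex x y))"
        using y W holomorphic_derivI[OF holg opW] by auto
      moreover have "((\<lambda>y. Complex x y) has_vector_derivative \<i>) (at y within {\<alpha>..\<beta>})"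
        unfolding Complex_eq by (auto intro!: derivative_eq_intros)
      ultimately show "((\<lambda>y. g (Complex x y)) has_vector_derivative ?d y * \<i>) (at y within {\<alpha>..\<beta>})"
        using field_vector_diff_chain_within[of "\<lambda>y. Complex x y" \<i> y "{\<alpha>..\<beta>}" g "?d y"]
        by (simp add: o_def DERIV_subset mult.commute)
    qed (use ab' in auto)
    then have "(\<lambda>y. ?d y * \<i>) integrable_on {\<alpha>..\<beta>}"
      "g (Complex x \<beta>) - g (Complex x \<alpha>) = integral {\<alpha>..\<beta>} (\<lambda>y. ?d y * \<i>)"
      by (auto simp: has_integral_iff)
    moreover have "(\<lambda>y. norm (?d y * \<i>)) integrable_on {\<alpha>..\<beta>}"
      by (intro integrable_continuous_real continuous_intros c)
    ultimately have "norm (g (Complex x \<beta>) - g (Complex x \<alpha>)) \<le> integral {\<alpha>..\<beta>} (\<lambda>y. norm (?d y * \<i>))"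
      using integral_norm_bound_integral[of "\<lambda>y. ?d y * \<i>" "{\<alpha>..\<beta>}" "\<lambda>y. norm (?d y * \<i>)"] by simp
    also have "\<dots> \<le> integral {\<alpha>..\<beta>} (\<lambda>y. (B / (2 * pi) + (norm (?d y))\<^sup>2 / (B / (2 * pi))) / 2)"
    proof (rule integral_le)
      show "norm (?d y * \<i>) \<le> (B / (2 * pi) + (norm (?d y))\<^sup>2 / (B / (2 * pi))) / 2" for y
        using pw[of "norm (?d y)"] by (simp add: norm_mult)
    qed (intro integrable_continuous_real continuous_intros c; use assms in simp)+
    also have "\<dots> = (B / (2 * pi) * (\<beta> - \<alpha>) + integral {\<alpha>..\<beta>} (\<lambda>y. (norm (?d y))\<^sup>2) / (B / (2 * pi))) / 2"
    proof -
      have "(\<lambda>y. (norm (?d y))\<^sup>2) integrable_on {\<alpha>..\<beta>}"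
        by (intro integrable_continuous_real continuous_intros c)
      then have "((\<lambda>y. (norm (?d y))\<^sup>2) has_integral integral {\<alpha>..\<beta>} (\<lambda>y. (norm (?d y))\<^sup>2)) {\<alpha>..\<beta>}"
        by auto
      then have "((\<lambda>y. (B / (2 * pi) + (norm (?d y))\<^sup>2 / (B / (2 * pi))) / 2) has_integral
          (measure lborel {\<alpha>..\<beta>} *\<^sub>R (B / (2 * pi)) + integral {\<alpha>..\<beta>} (\<lambda>y. (norm (?d y))\<^sup>2) / (B / (2 * pi))) / 2) {\<alpha>..\<beta>}"
        by (intro has_integral_divide has_integral_add has_integral_const_real)
      from integral_unique[OF this] show ?thesis using ab'
        by (simp only: content_real real_scaleR_def mult.commute[of "\<beta> - \<alpha>"])
    qed
    also have "\<dots> \<le> (B / (2 * pi) * (2 * pi) + \<kappa> / (B / (2 * pi))) / 2"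
    proof -
      let ?I = "integral {\<alpha>..\<beta>} (\<lambda>y. (norm (?d y))\<^sup>2)"
      have "ennreal ?I = (\<integral>\<^sup>+y. indicator {\<alpha>..\<beta>} y * (norm (?d y))\<^sup>2 \<partial>lborel)"
      proof -
        define q where "q = (\<lambda>y. indicator {\<alpha>..\<beta>} y *\<^sub>R (norm (?d y))\<^sup>2)"
        have "q \<in> borel_measurable borel" unfolding q_def
          by (intro borel_measurable_continuous_on_indicator continuous_intros c) auto
        moreover have "(q has_integral ?I) UNIV"
        proof -
          have "((\<lambda>y. (norm (?d y))\<^sup>2) has_integral ?I) {\<alpha>..\<beta>}"
            by (intro integrable_integral integrable_continuous_real continuous_intros c)
          then have "((\<lambda>y. if y \<in> {\<alpha>..\<beta>} then (norm (?d y))\<^sup>2 else 0) has_integral ?I) UNIV"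
            by (simp only: has_integral_restrict_UNIV)
          also have "(\<lambda>y. if y \<in> {\<alpha>..\<beta>} then (norm (?d y))\<^sup>2 else 0) = q"
            by (auto simp: q_def)
          finally show ?thesis .
        qed
        ultimately have "(\<integral>\<^sup>+y. ennreal (q y) \<partial>lborel) = ennreal ?I"
          by (intro nn_integral_has_integral_lborel) (auto simp: q_def)
        moreover have "q y = indicator {\<alpha>..\<beta>} y * (norm (?d y))\<^sup>2" for y
          by (auto simp: q_def indicator_def)
        ultimately show ?thesis by simp
      qed
      also have "\<dots> = (\<integral>\<^sup>+y. indicator {\<alpha>..\<beta>} y * h x y \<partial>lborel)"
        using W by (intro nn_integral_cong) (auto simp: h_def indicator_def)
      also have "\<dots> \<le> (\<integral>\<^sup>+y. indicator {0<..<2*pi} y * h x y \<partial>lborel)"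
        by (rule nn_integral_periodic_le[OF hm perh ab'])
      also note xk
      finally have "?I \<le> \<kappa>" by (simp add: \<kappa>_def)
      then show ?thesis using ab' assms
        by (intro divide_right_mono add_mono mult_left_mono) auto
    qed
    also have "\<dots> = B" using assms by (simp add: \<kappa>_def power2_eq_square field_simps)
    finally show ?thesis by (simp add: dist_norm norm_minus_commute)
  qed
  have main: "dist (g (Complex x \<alpha>)) (g (Complex x \<beta>)) \<le> B" if W: "\<And>t. \<alpha> \<le> t \<Longrightarrow> t \<le> \<beta> \<Longrightarrow> Complex x t \<in> W"
    and ab': "\<alpha> \<le> \<beta>" "\<beta> \<le> \<alpha> + 2 * pi" for \<alpha> \<beta>
  proof -
    define n where "n = \<lfloor>\<alpha> / (2 * pi)\<rfloor>"
    have per1: "P (Complex x (y - 2 * pi * of_int n)) = P (Complex x y)" for y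
    proof -
      have "exp (Complex x (y - 2 * pi * of_int n)) = exp (Complex x y)"
        unfolding exp_eq by (intro exI[of _ "- n"]) (simp add: complex_eq_iff)
      then show ?thesis by (simp add: P_def)
    qed
    have "of_int n \<le> \<alpha> / (2 * pi)" "\<alpha> / (2 * pi) < of_int n + 1" by (auto simp: n_def)
    then have n: "0 \<le> \<alpha> - 2 * pi * of_int n" "\<alpha> - 2 * pi * of_int n < 2 * pi"
      by (auto simp: field_simps)
    have "dist (g (Complex x (\<alpha> - 2 * pi * of_int n))) (g (Complex x (\<beta> - 2 * pi * of_int n))) \<le> B"
    proof (rule main0)
      fix t assume t: "\<alpha> - 2 * pi * of_int n \<le> t" "t \<le> \<beta> - 2 * pi * of_int n"
      have "P (Complex x t) = P (Complex x (t + 2 * pi * of_int n))"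
        using per1[of "t + 2 * pi * of_int n"] by simp
      moreover have "Complex x (t + 2 * pi * of_int n) \<in> W"
        using t by (intro W) auto
      ultimately show "Complex x t \<in> W" by (simp add: W_def)
    qed (use n ab' in auto)
    then show ?thesis by (simp add: g_def per1)
  qed
  show thesis
  proof (rule that[of "exp x"])
    show "r1 < exp x" "exp x < r2"
      using exp_less_mono[OF x(1)] exp_less_mono[OF x(2)] assms(5,6) by (auto simp: a_def b_def)
  next
    fix K u v assume K: "connected K" "K \<subseteq> sphere c (exp x) \<inter> U" "u \<in> K" "v \<in> K"
    have Pe: "c + of_real (exp x) * exp (\<i> * of_real t) = P (Complex x t)" for t
      by (simp add: P_def Complex_eq exp_add exp_of_real)
    obtain \<alpha> \<beta> where ab': "\<alpha> \<le> \<beta>" "\<beta> \<le> \<alpha> + 2 * pi" and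
      uv: "{u, v} = {P (Complex x \<alpha>), P (Complex x \<beta>)}" and
      "\<And>t. \<alpha> \<le> t \<Longrightarrow> t \<le> \<beta> \<Longrightarrow> P (Complex x t) \<in> K"
      using connected_subset_circle_arc[of K c "exp x" u v, unfolded Pe, OF K(1) _ _ K(3,4)] K(2)
      by (metis exp_gt_zero le_inf_iff)
    then have "dist (g (Complex x \<alpha>)) (g (Complex x \<beta>)) \<le> B"
      using K(2) by - (rule main, auto simp: W_def)
    then show "dist (f u) (f v) \<le> B" using uv
      by (auto simp: doubleton_eq_iff g_def dist_commute)
  qed
qed
section \<open>Jordan domains are locally connected at their boundary\<close>

text \<open>
  Every point \<^term>\<open>p\<close> of a closed Jordan curve cuts it, at any scale \<^term>\<open>\<eta>\<close>, into a short arc around \<^term>\<open>p\<close> and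
  a complementary arc that stays away from \<^term>\<open>p\<close>, because the parametrisation returns to \<^term>\<open>p\<close> only at its
  ends.
\<close>

lemma loop_local_split:
  fixes c :: "real \<Rightarrow> complex"
  assumes "simple_path c" "pathfinish c = pathstart c" "p \<in> path_image c" "\<eta> > 0"
  obtains J1 J2 \<delta> where "path_image c = J1 \<union> J2" "connected J1" "closed J1" "connected J2" "closed J2"
    "J1 \<subseteq> ball p \<eta>" "\<delta> > 0" "J2 \<inter> ball p \<delta> = {}"
proof -
  obtain a where a: "a \<in> {0..1}" "c a = p" using assms(3) by (auto simp: path_image_def)
  \<comment> \<open>Reparametrise so that the loop starts and ends at \<open>p\<close>.\<close>
  define d where "d = shiftpath a c"
  have d: "simple_path d" "path_image d = path_image c" "pathstart d = p" "pathfinish d = p"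
    using a assms by (auto simp: d_def simple_path_shiftpath path_image_shiftpath pathstart_shiftpath pathfinish_shiftpath)
  then have d01: "d 0 = p" "d 1 = p" and cont: "continuous_on {0..1} d"
    by (auto simp: pathstart_def pathfinish_def simple_path_def path_def)
  have "\<exists>\<epsilon>>0. \<forall>t\<in>{0..1}. dist t s < \<epsilon> \<longrightarrow> dist (d t) (d s) < \<eta>" if "s \<in> {0..1}" for s
    using cont that \<open>\<eta> > 0\<close> unfolding continuous_on_iff by blast
  then obtain e0 e1 where e0: "e0 > 0" "\<And>t. t \<in> {0..1} \<Longrightarrow> dist t 0 < e0 \<Longrightarrow> dist (d t) p < \<eta>"
    and e1: "e1 > 0" "\<And>t. t \<in> {0..1} \<Longrightarrow> dist t 1 < e1 \<Longrightarrow> dist (d t) p < \<eta>"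
    using d01 by (metis atLeastAtMost_iff order_refl zero_le_one)
  define e where "e = min (1 / 3) (min e0 e1 / 2)"
  have e: "0 < e" "e \<le> 1 / 3" "e < e0" "e < e1" using e0(1) e1(1) by (auto simp: e_def min_def)
  define J1 J2 where "J1 = d ` {0..e} \<union> d ` {1 - e..1}" and "J2 = d ` {e..1 - e}"
  have c3: "compact (d ` {0..e})" "compact (d ` {1 - e..1})" "compact (d ` {e..1 - e})"
    "connected (d ` {0..e})" "connected (d ` {1 - e..1})" "connected (d ` {e..1 - e})"
    using e by (auto intro!: compact_continuous_image connected_continuous_image intro: continuous_on_subset[OF cont])
  have "p \<notin> J2"
  proof
    assume "p \<in> J2"
    then obtain t where t: "t \<in> {e..1 - e}" "d t = d 0" using d01 by (auto simp: J2_def)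
    then have "t = 0 \<or> t = 1"
      using d(1) e unfolding simple_path_def loop_free_def by (smt (verit) atLeastAtMost_iff)
    then show False using t e by auto
  qed
  moreover have cl: "closed J2" using c3 by (simp add: J2_def compact_imp_closed)
  ultimately obtain \<delta> where "\<delta> > 0" "ball p \<delta> \<subseteq> - J2"
    by (metis ComplI openE open_Compl)
  show thesis
  proof (rule that[of J1 J2 \<delta>])
    have "{0..1} = {0..e} \<union> {1 - e..1} \<union> {e..1 - e}" using e by auto
    then show "path_image c = J1 \<union> J2"
      by (metis J1_def J2_def d(2) image_Un path_image_def)
    show "connected J1" unfolding J1_def
    proof (rule connected_Un)
      have "p \<in> d ` {0..e}" using e d01 by (intro image_eqI[of _ _ 0]) auto
      moreover have "p \<in> d ` {1 - e..1}" using e d01 by (intro image_eqI[of _ _ 1]) auto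
      ultimately show "d ` {0..e} \<inter> d ` {1 - e..1} \<noteq> {}" by blast
    qed (use c3 in auto)
    show "closed J1" using c3 by (simp add: J1_def compact_imp_closed closed_Un)
    show "connected J2" using c3 by (simp add: J2_def)
    show "J1 \<subseteq> ball p \<eta>"
      using e e0(2) e1(2) by (auto simp: J1_def dist_commute dist_real_def)
    show "J2 \<inter> ball p \<delta> = {}" using \<open>ball p \<delta> \<subseteq> - J2\<close> by blast
  qed (use cl \<open>\<delta> > 0\<close> in auto)
qed

lemma open_jordan_domain:
  assumes "jordan_domain D"
  shows "open D"
proof -
  obtain c where c: "simple_path c" "D \<in> components (- path_image c)"
    using assms by (auto simp: jordan_domain_def)
  have "closed (path_image c)" using c(1) by (simp add: closed_simple_path_image)
  then show ?thesis using c(2) open_components open_Compl by blast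
qed

lemma bounded_jordan_domain: "jordan_domain D \<Longrightarrow> bounded D"
  by (auto simp: jordan_domain_def)

lemma frontier_component_subset:
  fixes J :: "complex set"
  assumes "closed J" "D \<in> components (- J)"
  shows "frontier D \<subseteq> J"
  using frontier_of_components_subset[OF assms(2)] assms(1) frontier_subset_closed[of J] by auto

text \<open>
  Janiszewski's theorem joins two points without meeting \<open>S \<union> T\<close> once they can be joined off \<open>S\<close> and
  off \<open>T\<close>, provided \<open>S \<inter> T\<close> is connected. Here \<open>S\<close> is the curve, and \<open>T\<close> is the circle of radius
  \<^term>\<open>\<eta>\<close> together with the far arc \<open>J2\<close>; the near arc does not reach the circle, so the intersection is the
  connected set \<open>J2\<close>. Points of \<^term>\<open>D\<close> near \<^term>\<open>p\<close> can be joined off the curve inside \<^term>\<open>D\<close>, and off \<open>T\<close>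
  inside a small disk.
\<close>

lemma jordan_domain_locally_connected_at_frontier:
  assumes "jordan_domain D" "p \<in> frontier D" "\<eta> > 0"
  obtains \<delta> where "\<delta> > 0" "\<delta> \<le> \<eta>"
    "\<And>a b. a \<in> D \<inter> ball p \<delta> \<Longrightarrow> b \<in> D \<inter> ball p \<delta> \<Longrightarrow> connected_component (ball p \<eta> \<inter> D) a b"
proof -
  obtain c where c: "simple_path c" "pathfinish c = pathstart c" "D \<in> components (- path_image c)" "bounded D"
    using assms by (auto simp: jordan_domain_def)
  have clJ: "closed (path_image c)" using c(1) by (simp add: closed_simple_path_image)
  then have pJ: "p \<in> path_image c" using frontier_component_subset[OF _ c(3)] assms(2) by auto
  obtain J1 J2 \<delta> where J: "path_image c = J1 \<union> J2" "connected J1" "closed J1" "connected J2" "closed J2"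
    "J1 \<subseteq> ball p \<eta>" "\<delta> > 0" "J2 \<inter> ball p \<delta> = {}"
    using loop_local_split[OF c(1,2) pJ assms(3)] by blast
  define \<delta>' where "\<delta>' = min \<delta> \<eta>"
  have \<delta>': "\<delta>' > 0" "\<delta>' \<le> \<eta>" "\<delta>' \<le> \<delta>" using J(7) assms(3) by (auto simp: \<delta>'_def)
  define T where "T = sphere p \<eta> \<union> J2"
  have dT: "ball p \<delta>' \<inter> T = {}" using \<delta>' J(8) by (auto simp: T_def)
  show thesis
  proof (rule that[of \<delta>'])
    fix a b assume ab: "a \<in> D \<inter> ball p \<delta>'" "b \<in> D \<inter> ball p \<delta>'"
    have "connected_component (- (path_image c \<union> T)) a b"
    proof (rule Janiszewski)
      show "compact (path_image c)" using c(1) by (simp add: compact_simple_path_image)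
      show "closed T" using J by (simp add: T_def closed_Un)
      have "path_image c \<inter> T = J2" using J by (auto simp: T_def)
      then show "connected (path_image c \<inter> T)" using J by simp
      show "connected_component (- path_image c) a b"
        using ab c(3) by (metis IntD1 connected_component_of_subset connected_iff_connected_component in_components_connected in_components_subset)
      show "connected_component (- T) a b"
        using ab dT unfolding connected_component_def
        by (intro exI[of _ "ball p \<delta>'"]) auto
    qed
    then obtain X where X: "connected X" "X \<subseteq> - (path_image c \<union> T)" "a \<in> X" "b \<in> X"
      by (auto simp: connected_component_def)
    have "X \<subseteq> D" using ab X components_maximal[OF c(3) X(1)] by auto
    moreover have "X \<subseteq> ball p \<eta>"
    proof (rule ccontr)
      assume "\<not> X \<subseteq> ball p \<eta>"
      moreover have "a \<in> ball p \<eta>" using ab \<delta>' by auto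
      ultimately have "X \<inter> frontier (ball p \<eta>) \<noteq> {}" using X(1,3)
        by (intro connected_Int_frontier) auto
      then show False using X(2) assms(3) by (auto simp: T_def)
    qed
    ultimately show "connected_component (ball p \<eta> \<inter> D) a b"
      using X by (auto simp: connected_component_def)
  qed (use \<delta>' in auto)
qed

lemma frontier_ball_meets:
  assumes "p \<in> frontier D" "\<delta> > 0" "open D"
  shows "D \<inter> ball p \<delta> \<noteq> {}"
  using assms by (metis closure_iff_nhds_not_empty frontier_def Diff_iff centre_in_ball inf_commute open_ball order_refl)

section \<open>The components \<open>C(D; \<zeta>, r)\<close>\<close>

text \<open>
  By local connectedness all points of \<^term>\<open>D\<close> close to \<^term>\<open>p\<close> lie in one component of \<^term>\<open>ball p r \<inter> D\<close>, which is
  then the only component that can accumulate at \<^term>\<open>p\<close>.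
\<close>

lemma boundary_comp_unique:
  assumes D: "jordan_domain D" and p: "p \<in> frontier D" and r: "r > 0"
  shows "\<exists>!C. C \<in> components (ball p r \<inter> D) \<and> p \<in> frontier C"
    and "\<exists>\<delta>>0. \<delta> \<le> r \<and> D \<inter> ball p \<delta> \<subseteq> boundary_comp D p r"
proof -
  note opD = open_jordan_domain[OF D]
  obtain \<delta> where \<delta>: "\<delta> > 0" "\<delta> \<le> r"
    "\<And>a b. a \<in> D \<inter> ball p \<delta> \<Longrightarrow> b \<in> D \<inter> ball p \<delta> \<Longrightarrow> connected_component (ball p r \<inter> D) a b"
    using jordan_domain_locally_connected_at_frontier[OF D p r] by blast
  obtain a where a: "a \<in> D \<inter> ball p \<delta>" using frontier_ball_meets[OF p \<delta>(1) opD] by blast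
  define C where "C = connected_component_set (ball p r \<inter> D) a"
  have pD: "p \<notin> D" using p opD frontier_disjoint_eq by fastforce
  have C: "C \<in> components (ball p r \<inter> D)" using a \<delta>(2) by (auto simp: C_def components_def)
  have sub: "D \<inter> ball p \<delta> \<subseteq> C" using \<delta>(3) a by (auto simp: C_def)
  have "p \<in> closure C"
    using closure_mono[OF sub] open_Int_closure_subset[OF open_ball, of p \<delta> D] p \<delta>(1)
    by (auto simp: frontier_def Int_commute)
  moreover have "p \<notin> C" using C pD in_components_subset by blast
  ultimately have pC: "p \<in> frontier C"
    using interior_subset by (auto simp: frontier_def)
  have uniq: "C' = C" if C': "C' \<in> components (ball p r \<inter> D)" "p \<in> frontier C'" for C'
  proof -
    have "p \<in> closure C'" using C' by (simp add: frontier_def)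
    then obtain x where "x \<in> C'" "x \<in> ball p \<delta>"
      using \<delta>(1) by (auto simp: closure_approachable dist_commute)
    then have "x \<in> C" using sub C' in_components_subset by blast
    then show ?thesis using \<open>x \<in> C'\<close> C C'(1) components_eq by blast
  qed
  show ex: "\<exists>!C. C \<in> components (ball p r \<inter> D) \<and> p \<in> frontier C"
    using C pC uniq by blast
  have "boundary_comp D p r = C"
    unfolding boundary_comp_def using C pC the1_equality[OF ex] by blast
  then show "\<exists>\<delta>>0. \<delta> \<le> r \<and> D \<inter> ball p \<delta> \<subseteq> boundary_comp D p r"
    using sub \<delta> by auto
qed

lemma boundary_comp_properties:
  assumes "jordan_domain D" "p \<in> frontier D" "r > 0"
  shows "boundary_comp D p r \<in> components (ball p r \<inter> D)" "p \<in> frontier (boundary_comp D p r)"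
    and boundary_comp_eqI: "\<And>C. C \<in> components (ball p r \<inter> D) \<Longrightarrow> p \<in> closure C \<Longrightarrow> boundary_comp D p r = C"
proof -
  note ex = boundary_comp_unique(1)[OF assms]
  show 1: "boundary_comp D p r \<in> components (ball p r \<inter> D)" "p \<in> frontier (boundary_comp D p r)"
    using theI'[OF ex] by (auto simp: boundary_comp_def)
  fix C assume C: "C \<in> components (ball p r \<inter> D)" "p \<in> closure C"
  have "p \<notin> D" using assms(2) open_jordan_domain[OF assms(1)] frontier_disjoint_eq by fastforce
  then have "p \<notin> interior C" using C(1) in_components_subset interior_subset by blast
  then have "p \<in> frontier C" using C by (simp add: frontier_def)
  then show "boundary_comp D p r = C"
    unfolding boundary_comp_def using C(1) the1_equality[OF ex] by blast
qed

text \<open>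
  The component accumulating at a boundary point depends only locally on that point, hence it stays
  the same along connected pieces of the boundary: the set of points of \<^term>\<open>A\<close> in \<^term>\<open>closure X\<close> is
  open and closed in \<^term>\<open>A\<close>.
\<close>

lemma frontier_arc_stays_at_component:
  assumes D: "jordan_domain D" and X: "X \<in> components (ball \<zeta> r \<inter> D)"
    and A: "connected A" "A \<subseteq> frontier D \<inter> ball \<zeta> r" "q \<in> A" "q \<in> closure X"
  shows "A \<subseteq> closure X"
proof -
  define P where "P = A \<inter> closure X"
  have "openin (top_of_set A) P"
  proof (subst openin_contains_ball, intro conjI ballI)
    fix x assume x: "x \<in> P"
    then have xA: "x \<in> A" and xf: "x \<in> frontier D" and xb: "x \<in> ball \<zeta> r" and xX: "x \<in> closure X"
      using A by (auto simp: P_def)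
    define \<eta> where "\<eta> = r - dist \<zeta> x"
    have "ball x \<eta> \<subseteq> ball \<zeta> r"
    proof
      fix y assume "y \<in> ball x \<eta>"
      then show "y \<in> ball \<zeta> r" using dist_triangle[of \<zeta> y x] by (simp add: \<eta>_def)
    qed
    then have \<eta>: "\<eta> > 0" "ball x \<eta> \<subseteq> ball \<zeta> r" using xb by (auto simp: \<eta>_def)
    obtain \<delta> where \<delta>: "\<delta> > 0" "\<delta> \<le> \<eta>"
      "\<And>a b. a \<in> D \<inter> ball x \<delta> \<Longrightarrow> b \<in> D \<inter> ball x \<delta> \<Longrightarrow> connected_component (ball x \<eta> \<inter> D) a b"
      using jordan_domain_locally_connected_at_frontier[OF D xf \<eta>(1)] by blast
    obtain a where a: "a \<in> X" "a \<in> ball x \<delta>" using xX \<delta>(1)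
      by (auto simp: closure_approachable dist_commute)
    have XD: "X \<subseteq> ball \<zeta> r \<inter> D" using X in_components_subset by blast
    have sub: "D \<inter> ball x \<delta> \<subseteq> X"
    proof
      fix b assume b: "b \<in> D \<inter> ball x \<delta>"
      then have "connected_component (ball x \<eta> \<inter> D) a b" using \<delta>(3) a XD by blast
      then obtain Y where Y: "connected Y" "Y \<subseteq> ball x \<eta> \<inter> D" "a \<in> Y" "b \<in> Y"
        by (auto simp: connected_component_def)
      then have "Y \<subseteq> X"
        using \<eta>(2) a(1) by (intro components_maximal[OF X]) auto
      then show "b \<in> X" using Y by blast
    qed
    have "ball x \<delta> \<inter> A \<subseteq> P"
    proof
      fix y assume y: "y \<in> ball x \<delta> \<inter> A"
      then have "y \<in> closure D" using A(2) by (auto simp: frontier_def)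
      then have "y \<in> closure (ball x \<delta> \<inter> D)"
        using y open_Int_closure_subset[OF open_ball, of x \<delta> D] by blast
      then show "y \<in> P" using y closure_mono[OF sub] by (auto simp: P_def Int_commute)
    qed
    then show "\<exists>e>0. ball x e \<inter> A \<subseteq> P" using \<delta>(1) by blast
  qed (auto simp: P_def)
  moreover have "closedin (top_of_set A) P" by (auto simp: P_def closedin_closed_Int)
  ultimately have "P = {} \<or> P = A" using A(1) unfolding connected_clopen by blast
  then show ?thesis using A by (auto simp: P_def)
qed

text \<open>
  The segment from \<^term>\<open>z\<close> to \<^term>\<open>\<zeta>\<close> leaves \<^term>\<open>D\<close> first at some boundary point \<open>q\<close>, still within \<open>1 / 2 ^ g k\<close> of
  \<^term>\<open>\<zeta>\<close>. The modulus supplies a boundary arc from \<open>q\<close> to \<^term>\<open>\<zeta>\<close> inside the disk of radius \<^term>\<open>r\<close>, along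
  which the component of \<^term>\<open>z\<close> keeps accumulating until \<^term>\<open>\<zeta>\<close> is reached.
\<close>

lemma modulus_imp_in_boundary_comp:
  assumes D: "jordan_domain D" and \<zeta>: "\<zeta> \<in> frontier D" and g: "local_connectivity_modulus (frontier D) g"
    and z: "z \<in> D" "norm (z - \<zeta>) < 1 / 2 ^ g k" and r: "1 / 2 ^ k + 1 / 2 ^ g k \<le> r"
  shows "z \<in> boundary_comp D \<zeta> r"
proof -
  note opD = open_jordan_domain[OF D]
  define \<rho> :: real where "\<rho> = 1 / 2 ^ g k"
  have \<rho>: "\<rho> > 0" "\<rho> \<le> r" "1 / 2 ^ k \<le> r" "dist z \<zeta> < \<rho>" using r z(2)
    by (auto simp: \<rho>_def dist_norm) (smt (verit) zero_less_divide_1_iff zero_less_power)+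
  have r0: "r > 0" using \<rho> by linarith
  define X where "X = connected_component_set (ball \<zeta> r \<inter> D) z"
  have zb: "z \<in> ball \<zeta> r \<inter> D" using z(1) \<rho> by (auto simp: dist_commute)
  have X: "X \<in> components (ball \<zeta> r \<inter> D)" using zb by (auto simp: X_def components_def)
  have \<zeta>D: "\<zeta> \<notin> D" using \<zeta> opD frontier_disjoint_eq by fastforce
  let ?l = "linepath z \<zeta>"
  obtain u where u: "0 \<le> u" "u \<le> 1" "\<And>x. 0 \<le> x \<and> x < u \<Longrightarrow> ?l x \<in> interior D" "?l u \<notin> interior D" "u = 0 \<or> ?l u \<in> closure D"
    using subpath_to_frontier_explicit[of ?l D] z(1) \<zeta>D by (auto intro: closure_subset[THEN subsetD])
  define q where "q = ?l u"
  have u0: "u \<noteq> 0"  using u(4) z(1) opD by (auto simp: interior_open linepath_0')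
  then have qf: "q \<in> frontier D" using u by (auto simp: q_def frontier_def)
  have lb: "?l x \<in> ball \<zeta> \<rho>" if "0 \<le> x" "x \<le> 1" for x
  proof -
    have "?l x \<in> closed_segment z \<zeta>" using that by (auto simp: linepath_in_path)
    moreover have "closed_segment z \<zeta> \<subseteq> ball \<zeta> \<rho>"
      by (rule closed_segment_subset) (use \<rho> in \<open>auto simp: dist_commute\<close>)
    ultimately show ?thesis by blast
  qed
  have "?l ` {0..<u} \<subseteq> X"
  proof -
    have "?l ` {0..<u} \<subseteq> ball \<zeta> r \<inter> D"
      using u(2,3) lb \<rho>(2) opD by (force simp: interior_open)
    moreover have "connected (?l ` {0..<u})"
      by (intro connected_continuous_image continuous_on_linepath) auto
    moreover have "z \<in> ?l ` {0..<u}" using u0 u(1) by (intro image_eqI[of _ _ 0]) (auto simp: linepath_0')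
    ultimately show ?thesis unfolding X_def by (intro connected_component_maximal)
  qed
  moreover have "q \<in> closure (?l ` {0..<u})"
  proof -
    have "?l ` closure {0..<u} \<subseteq> closure (?l ` {0..<u})"
      by (rule image_closure_subset) (auto intro!: continuous_on_linepath closure_subset)
    moreover have "u \<in> closure {0..<u}" using u0 u(1) by simp
    ultimately show ?thesis by (auto simp: q_def)
  qed
  ultimately have qX: "q \<in> closure X" using closure_mono by blast
  have "\<zeta> \<in> closure X"
  proof (cases "q = \<zeta>")
    case False
    have "dist q \<zeta> \<le> 1 / 2 ^ g k" using lb[OF u(1,2)] by (auto simp: q_def \<rho>_def dist_commute)
    then obtain \<gamma> where \<gamma>: "arc \<gamma>" "path_image \<gamma> \<subseteq> frontier D" "pathstart \<gamma> = q" "pathfinish \<gamma> = \<zeta>"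
      "diameter (path_image \<gamma>) < 1 / 2 ^ k"
      using g qf \<zeta> False unfolding local_connectivity_modulus_def by (metis zero_less_dist_iff)
    have "path_image \<gamma> \<subseteq> ball \<zeta> r"
    proof
      fix x assume x: "x \<in> path_image \<gamma>"
      have "dist \<zeta> x \<le> diameter (path_image \<gamma>)"
        using \<gamma> x by (intro diameter_bounded_bound) (auto simp: compact_imp_bounded compact_arc_image)
      then show "x \<in> ball \<zeta> r" using \<gamma>(5) \<rho>(3) by simp
    qed
    then have "path_image \<gamma> \<subseteq> closure X"
      using \<gamma> qX by (intro frontier_arc_stays_at_component[OF D X, where q=q]) (auto simp: connected_arc_image)
    then show ?thesis using \<gamma>(4) by (metis pathfinish_in_path_image subsetD)
  qed (use qX in simp)
  then have "boundary_comp D \<zeta> r = X" by (rule boundary_comp_eqI[OF D \<zeta> r0 X])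
  then show ?thesis using zb by (simp add: X_def)
qed

section \<open>Crosscuts and the images of boundary neighbourhoods\<close>

text \<open>
  In the plane a closed set separating two points has a component that already separates them. The
  crosscut argument needs this inside a domain homeomorphic to the plane, for relatively closed sets.
\<close>

lemma separation_by_component_closedin:
  fixes D T :: "complex set"
  assumes "D homeomorphic (UNIV :: complex set)" "closedin (top_of_set D) T" "a \<in> D" "b \<in> D"
    and "\<not> connected_component (D - T) a b"
  obtains G where "G \<in> components T" "\<not> connected_component (D - G) a b"
proof -
  obtain h k where hk: "homeomorphism D (UNIV :: complex set) h k"
    using assms(1) by (auto simp: homeomorphic_def)
  have kh: "k (h x) = x" if "x \<in> D" for x using hk that by (simp add: homeomorphism_def)
  have hk': "h (k y) = y" for y using hk by (simp add: homeomorphism_def)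
  have kD: "k y \<in> D" for y using hk by (auto simp: homeomorphism_def)
  have contk: "continuous_on UNIV k" and conth: "continuous_on D h" using hk by (auto simp: homeomorphism_def)
  have TD: "T \<subseteq> D" using assms(2) closedin_imp_subset by blast
  have "closed (h ` T)" using homeomorphism_imp_closed_map[OF hk assms(2)] by simp
  moreover have "\<not> connected_component (- (h ` T)) (h a) (h b)"
  proof
    assume "connected_component (- (h ` T)) (h a) (h b)"
    then obtain X where X: "connected X" "X \<subseteq> - (h ` T)" "h a \<in> X" "h b \<in> X"
      by (auto simp: connected_component_def)
    have "connected (k ` X)"
      by (intro connected_continuous_image X continuous_on_subset[OF contk]) auto
    moreover have "k ` X \<subseteq> D - T" using X(2) kD hk' by (force simp: image_iff)
    moreover have "a \<in> k ` X" "b \<in> k ` X" using X kh assms by (metis image_eqI)+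
    ultimately have "connected_component (D - T) a b"
      unfolding connected_component_def by blast
    then show False using assms(5) by contradiction
  qed
  ultimately obtain C where C: "C \<in> components (h ` T)" "\<not> connected_component (- C) (h a) (h b)"
    using separation_by_component_closed_pointwise by blast
  have CT: "C \<subseteq> h ` T" "C \<noteq> {}" "connected C"
    using C(1) in_components_subset in_components_nonempty in_components_connected by auto
  show thesis
  proof (rule that[of "k ` C"])
    show "k ` C \<in> components T" unfolding in_components_maximal
    proof (intro conjI allI impI)
      show "k ` C \<subseteq> T" using CT kh TD by fastforce
      show "connected (k ` C)"
        by (intro connected_continuous_image CT continuous_on_subset[OF contk]) auto
      fix Y assume Y: "Y \<noteq> {} \<and> k ` C \<subseteq> Y \<and> Y \<subseteq> T \<and> connected Y"
      have "connected (h ` Y)" using Y TD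
        by (intro connected_continuous_image continuous_on_subset[OF conth]) auto
      moreover have "C \<subseteq> h ` Y" using Y hk' by (force simp: image_iff)
      ultimately have "h ` Y \<subseteq> C" using CT Y by (intro components_maximal[OF C(1)]) auto
      have "Y \<subseteq> k ` C"
      proof
        fix y assume "y \<in> Y"
        then have "h y \<in> C" "k (h y) = y" using \<open>h ` Y \<subseteq> C\<close> kh Y TD by auto
        then show "y \<in> k ` C" by force
      qed
      then show "Y = k ` C" using Y by auto
    qed (use CT in auto)
    show "\<not> connected_component (D - k ` C) a b"
    proof
      assume "connected_component (D - k ` C) a b"
      then obtain X where X: "connected X" "X \<subseteq> D - k ` C" "a \<in> X" "b \<in> X"
        by (auto simp: connected_component_def)
      have "connected (h ` X)" using X
        by (intro connected_continuous_image continuous_on_subset[OF conth]) auto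
      moreover have "h ` X \<subseteq> - C"
      proof
        fix y assume "y \<in> h ` X"
        then obtain x where x: "x \<in> X" "y = h x" by blast
        then have "k y \<notin> k ` C" using X(2) kh by auto
        then show "y \<in> - C" by blast
      qed
      moreover have "h a \<in> h ` X" "h b \<in> h ` X" using X by auto
      ultimately have "connected_component (- C) (h a) (h b)"
        unfolding connected_component_def by blast
      then show False using C(2) by contradiction
    qed
  qed
qed

text \<open>
  For \<open>\<bar>p\<bar> = 1\<close> this is Thales' theorem: the angle at \<^term>\<open>p\<close> between \<^term>\<open>w1\<close> and \<^term>\<open>- w1\<close> is right, so moving
  from \<^term>\<open>p\<close> towards the antipode of \<^term>\<open>w1\<close> increases the distance to \<^term>\<open>w1\<close>. Shrinking the antipode by
  \<open>\<bar>p\<bar>\<close> keeps the angle at least right and, for \<open>\<bar>p\<bar> < 1\<close>, the target inside the open disk.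
\<close>

lemma segment_away_from_circle_point:
  fixes p w1 :: complex
  assumes "norm p \<le> 1" "norm w1 = 1" "x \<in> closed_segment p (- of_real (norm p) * w1)"
  shows "dist w1 p \<le> dist w1 x"
proof -
  define q where "q = - of_real (norm p) * w1"
  obtain u where u: "0 \<le> u" "u \<le> 1" "x = (1 - u) *\<^sub>R p + u *\<^sub>R q"
    using assms(3) by (auto simp: in_segment q_def)
  have "0 \<le> (p - w1) \<bullet> (q - p)"
  proof -
    have "q = - (norm p *\<^sub>R w1)" by (simp add: q_def scaleR_conv_of_real)
    then have "(p - w1) \<bullet> (q - p) = norm p - (norm p)\<^sup>2 + (1 - norm p) * (p \<bullet> w1)"
      using assms(2)
      by (simp add: inner_diff_left inner_diff_right inner_commute power2_norm_eq_inner[symmetric] algebra_simps dot_square_norm)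
    moreover have "- norm p \<le> p \<bullet> w1"
      using Cauchy_Schwarz_ineq2[of p w1] assms(2) by simp
    then have "(1 - norm p) * (- norm p) \<le> (1 - norm p) * (p \<bullet> w1)"
      using assms(1) by (intro mult_left_mono) auto
    ultimately show ?thesis by (simp add: power2_eq_square algebra_simps)
  qed
  then have "(norm (p - w1))\<^sup>2 \<le> (norm (p - w1 + u *\<^sub>R (q - p)))\<^sup>2"
    using u(1) by (simp add: power2_norm_eq_inner inner_add_left inner_add_right inner_commute)
  moreover have "p - w1 + u *\<^sub>R (q - p) = x - w1" using u(3) by (simp add: algebra_simps)
  ultimately have "norm (p - w1) \<le> norm (x - w1)"
    by (metis norm_ge_zero power2_le_imp_le)
  then show ?thesis by (simp add: dist_norm norm_minus_commute)
qed

lemma inner_radius_exists: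
  fixes R B K :: real
  assumes "R > 0" "B > 0" "K \<ge> 0"
  obtains r1 where "0 < r1" "r1 < R" "K < B\<^sup>2 * ln (R / r1)"
proof (rule that[of "R * exp (- (K / B\<^sup>2 + 1))"])
  let ?q = "K / B\<^sup>2 + 1"
  have q: "0 < ?q" using assms by (simp add: add_nonneg_pos)
  then show "R * exp (- ?q) < R" "0 < R * exp (- ?q)" using assms by simp_all
  have "R / (R * exp (- ?q)) = exp ?q" using assms by (simp add: exp_minus field_simps)
  then have "B\<^sup>2 * ln (R / (R * exp (- ?q))) = B\<^sup>2 * ?q" by (simp only: ln_exp)
  also have "\<dots> = K + B\<^sup>2" using assms by (simp add: distrib_left)
  finally show "K < B\<^sup>2 * ln (R / (R * exp (- ?q)))" using assms by simp
qed

locale conformal_disk =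
  fixes \<phi> :: "complex \<Rightarrow> complex" and D :: "complex set"
  assumes open_D: "open D" and hol: "\<phi> holomorphic_on D" and bij: "bij_betw \<phi> D (ball 0 1)"
begin

definition "\<psi> = inv_into D \<phi>"

lemma psi_phi: "z \<in> D \<Longrightarrow> \<psi> (\<phi> z) = z"
  using bij by (simp add: \<psi>_def bij_betw_def inv_into_f_f)

lemma phi_psi: "w \<in> ball 0 1 \<Longrightarrow> \<phi> (\<psi> w) = w"
  using bij by (simp add: \<psi>_def bij_betw_def f_inv_into_f)

lemma psi_in: "w \<in> ball 0 1 \<Longrightarrow> \<psi> w \<in> D"
  using bij by (metis \<psi>_def bij_betw_def inv_into_into)

lemma phi_in: "z \<in> D \<Longrightarrow> \<phi> z \<in> ball 0 1"
  using bij by (auto simp: bij_betw_def)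

lemma inj_phi: "inj_on \<phi> D" using bij by (simp add: bij_betw_def)

lemma inj_psi: "inj_on \<psi> (ball 0 1)" by (metis inj_onI phi_psi)

lemma image_psi: "\<psi> ` ball 0 1 = D"
proof
  show "D \<subseteq> \<psi> ` ball 0 1"
    using psi_phi phi_in by (metis image_eqI subsetI)
qed (use psi_in in auto)

lemma hol_psi: "\<psi> holomorphic_on ball 0 1"
proof -
  obtain g where g: "g holomorphic_on (\<phi> ` D)" "\<And>z. z \<in> D \<Longrightarrow> g (\<phi> z) = z"
    using holomorphic_has_inverse[OF hol open_D inj_phi] by metis
  have im: "\<phi> ` D = ball 0 1" using bij by (simp add: bij_betw_def)
  have "g w = \<psi> w" if "w \<in> ball 0 1" for w
    using g(2)[OF psi_in[OF that]] phi_psi[OF that] by simp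
  then show ?thesis using g(1) unfolding im by (rule holomorphic_transform[rotated])
qed

lemma homeomorphism_phi_psi: "homeomorphism D (ball 0 1) \<phi> \<psi>"
  unfolding homeomorphism_def
  using psi_phi phi_psi image_psi bij hol hol_psi holomorphic_on_imp_continuous_on
  by (simp add: bij_betw_def)

lemma homeomorphic_UNIV: "D homeomorphic (UNIV :: complex set)"
  using homeomorphism_phi_psi homeomorphic_ball_UNIV[of 1 "0::complex"] homeomorphic_trans
  by (metis homeomorphic_def zero_less_one)

lemma simply_connected_D: "simply_connected D"
  using homeomorphic_simply_connected_eq[of D "ball (0::complex) 1"] homeomorphism_phi_psi
  by (metis convex_ball convex_imp_simply_connected homeomorphic_def)

text \<open>
  Otherwise \<^term>\<open>G\<close> would be compact, hence both open and closed in the circle, hence the whole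
  circle. The simply connected \<^term>\<open>D\<close> would then contain a circle that winds around \<^term>\<open>\<zeta>\<close> outside \<^term>\<open>D\<close>.
\<close>

lemma circle_component_reaches_unit_circle:
  assumes "\<zeta> \<notin> D" "r > 0" "G \<in> components (sphere \<zeta> r \<inter> D)"
  obtains w where "w \<in> closure (\<phi> ` G)" "norm w = 1"
proof -
  define K where "K = closure (\<phi> ` G)"
  have G: "G \<subseteq> sphere \<zeta> r \<inter> D" "G \<noteq> {}"
    using assms(3) in_components_subset in_components_nonempty by auto
  have False if no: "\<And>w. w \<in> K \<Longrightarrow> norm w \<noteq> 1"
  proof -
    have "K \<subseteq> cball 0 1" unfolding K_def
      by (rule closure_minimal) (use G phi_in in force)+
    then have K1: "K \<subseteq> ball 0 1" using no by force
    have clK: "compact K" unfolding K_def compact_closure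
      by (rule bounded_subset[of "ball 0 1"]) (use G phi_in in auto)
    have "closedin (top_of_set D) (sphere \<zeta> r \<inter> D)"
      by (metis Int_commute closed_sphere closedin_closed_Int)
    then have "closedin (top_of_set D) G"
      by (rule closedin_trans[OF closedin_component[OF assms(3)]])
    then have "closedin (top_of_set (ball 0 1)) (\<phi> ` G)"
      by (rule homeomorphism_imp_closed_map[OF homeomorphism_phi_psi])
    then obtain V where V: "closed V" "\<phi> ` G = ball 0 1 \<inter> V"
      by (auto simp: closedin_closed)
    then have "K \<subseteq> V" unfolding K_def by (intro closure_minimal) auto
    then have "K = \<phi> ` G" using K1 V(2) closure_subset[of "\<phi> ` G"] by (auto simp: K_def)
    have "\<psi> ` \<phi> ` G = (\<lambda>z. z) ` G"
      unfolding image_image using G(1) by (intro image_cong psi_phi) auto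
    then have "G = \<psi> ` K" unfolding \<open>K = \<phi> ` G\<close> by simp
    moreover have "continuous_on K \<psi>"
      by (rule continuous_on_subset[OF holomorphic_on_imp_continuous_on[OF hol_psi] K1])
    ultimately have "compact G"
      using compact_continuous_image[OF _ clK] by simp
    then have "closedin (top_of_set (sphere \<zeta> r)) G"
      using G by (intro closed_subset compact_imp_closed) auto
    moreover have "openin (top_of_set (sphere \<zeta> r)) G"
    proof -
      have o: "openin (top_of_set (sphere \<zeta> r)) (sphere \<zeta> r \<inter> D)"
        by (rule openin_open_Int[OF open_D])
      then have "locally connected (sphere \<zeta> r \<inter> D)"
        by (rule locally_open_subset[OF locally_connected_sphere])
      then show ?thesis
        by (rule openin_trans[OF openin_components_locally_connected[OF _ assms(3)] o])
    qed
    moreover have "connected (sphere \<zeta> r)" by (simp add: connected_sphere)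
    ultimately have "G = sphere \<zeta> r" using G(2) unfolding connected_clopen by blast
    then have sub: "sphere \<zeta> r \<subseteq> D" using G by auto
    have "winding_number (circlepath \<zeta> r) \<zeta> = 0"
      by (rule simply_connected_imp_winding_number_zero[OF simply_connected_D]) (use assms sub in auto)
    then show False using winding_number_circlepath_centre[OF assms(2), of \<zeta>] by simp
  qed
  then show thesis using that unfolding K_def by blast
qed

text \<open>
  On a circle given by the length-area principle, the part in \<^term>\<open>D\<close> separates a component \<open>C\<close> inside the
  circle from \<open>\<psi> 0\<close>, which is outside. A single component \<open>G\<close> of that part already separates them. The
  set \<open>\<phi> ` G\<close> has diameter at most \<^term>\<open>B\<close> and accumulates at a point \<open>w1\<close> of the unit circle, so it lies in
  \<open>cball w1 B\<close>. A point of \<open>\<phi> ` C\<close> outside this disk could be joined to 0 within the unit disk and outside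
  \<open>cball w1 B\<close>, hence without meeting \<open>\<phi> ` G\<close>.
\<close>

lemma crosscut_estimate:
  assumes "\<zeta> \<notin> D" "0 < r1" "r1 < norm (\<zeta> - \<psi> 0)" "0 < B" "B < 1"
    and "2 * pi\<^sup>2 < B\<^sup>2 * ln (norm (\<zeta> - \<psi> 0) / r1)"
  obtains r where "r1 < r" "r < norm (\<zeta> - \<psi> 0)"
    "\<And>C. C \<in> components (ball \<zeta> r \<inter> D) \<Longrightarrow> \<exists>w. \<phi> ` C \<subseteq> cball w B"
proof -
  have im: "\<phi> ` D \<subseteq> ball 0 1" using phi_in by auto
  have ln: "2 * pi\<^sup>2 * 1\<^sup>2 < B\<^sup>2 * ln (norm (\<zeta> - \<psi> 0) / r1)" using assms(6) by simp
  obtain r where r: "r1 < r" "r < norm (\<zeta> - \<psi> 0)"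
    and osc: "\<And>K x y. connected K \<Longrightarrow> K \<subseteq> sphere \<zeta> r \<inter> D \<Longrightarrow> x \<in> K \<Longrightarrow> y \<in> K \<Longrightarrow> dist (\<phi> x) (\<phi> y) \<le> B"
    by (rule length_area[OF open_D hol inj_phi im assms(2,3,4) ln, where c=\<zeta>]) blast
  have r0: "r > 0" using r assms by simp
  define T where "T = sphere \<zeta> r \<inter> D"
  have psi0: "\<psi> 0 \<in> D" by (simp add: psi_in)
  show thesis
  proof (rule that[OF r])
    fix C assume C: "C \<in> components (ball \<zeta> r \<inter> D)"
    then obtain z where z: "z \<in> C" using in_components_nonempty by blast
    have CS: "C \<subseteq> ball \<zeta> r \<inter> D" "connected C" using C in_components_subset in_components_connected by auto
    have "\<not> connected_component (D - T) z (\<psi> 0)"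
    proof
      assume "connected_component (D - T) z (\<psi> 0)"
      then obtain X where X: "connected X" "X \<subseteq> D - T" "z \<in> X" "\<psi> 0 \<in> X"
        by (auto simp: connected_component_def)
      have "X \<inter> frontier (ball \<zeta> r) \<noteq> {}"
        using X z CS r by (intro connected_Int_frontier) (auto simp: dist_norm)
      then show False using X(2) r0 by (auto simp: T_def)
    qed
    moreover have "closedin (top_of_set D) T"
      unfolding T_def by (metis Int_commute closed_sphere closedin_closed_Int)
    ultimately obtain G where G: "G \<in> components T" "\<not> connected_component (D - G) z (\<psi> 0)"
      using separation_by_component_closedin[OF homeomorphic_UNIV] z CS psi0 by blast
    have GS: "G \<subseteq> T" "connected G" using G in_components_subset in_components_connected by auto
    obtain w1 where w1: "w1 \<in> closure (\<phi> ` G)" "norm w1 = 1"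
      using circle_component_reaches_unit_circle[OF assms(1) r0] G(1) by (auto simp: T_def)
    have GB: "dist w1 (\<phi> y) \<le> B" if "y \<in> G" for y
    proof -
      have "\<phi> ` G \<subseteq> cball (\<phi> y) B" using osc[OF GS(2)] GS(1) that by (auto simp: T_def)
      then have "w1 \<in> cball (\<phi> y) B" using w1(1) closure_minimal[OF _ closed_cball] by blast
      then show ?thesis by (simp add: dist_commute)
    qed
    have "\<phi> u \<in> cball w1 B" if u: "u \<in> C" for u
    proof (rule ccontr)
      assume neg: "\<phi> u \<notin> cball w1 B"
      define p where "p = \<phi> u"
      define q where "q = - of_real (norm p) * w1"
      have p1: "norm p < 1" using u CS phi_in by (auto simp: p_def)
      have q1: "norm q < 1" using p1 w1 by (simp add: q_def norm_mult)
      \<comment> \<open>First towards the point opposite to \<open>w1\<close>, then along a radius to 0; since \<open>B < 1\<close>, the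
          radius opposite to \<open>w1\<close> avoids \<open>cball w1 B\<close>.\<close>
      define S where "S = closed_segment p q \<union> closed_segment q 0"
      have S1: "S \<subseteq> ball 0 1" unfolding S_def
        using p1 q1 by (intro Un_least closed_segment_subset) auto
      have Sfar: "dist w1 x > B" if "x \<in> S" for x
        using that unfolding S_def
      proof
        assume "x \<in> closed_segment p q"
        then have "dist w1 p \<le> dist w1 x"
          using segment_away_from_circle_point[of p w1 x] p1 w1(2) by (simp add: q_def)
        then show ?thesis using neg by (simp add: p_def)
      next
        assume "x \<in> closed_segment q 0"
        then obtain t where t: "0 \<le> t" "t \<le> 1" "x = (1 - t) *\<^sub>R q" by (auto simp: in_segment)
        then have "w1 - x = of_real (1 + (1 - t) * norm p) * w1"
          by (simp add: q_def scaleR_conv_of_real algebra_simps)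
        then have "dist w1 x = \<bar>1 + (1 - t) * norm p\<bar>" using w1(2)
          by (simp only: dist_norm norm_mult norm_of_real) simp
        moreover have "0 \<le> (1 - t) * norm p" using t by simp
        ultimately show ?thesis using assms(5) by simp
      qed
      have conS: "connected (\<psi> ` S)"
      proof (rule connected_continuous_image)
        show "continuous_on S \<psi>" using S1 hol_psi continuous_on_subset holomorphic_on_imp_continuous_on by blast
        show "connected S" unfolding S_def by (intro connected_Un connected_segment) auto
      qed
      have uS: "u \<in> \<psi> ` S" using u CS psi_phi[of u] by (intro image_eqI[of _ _ p]) (auto simp: S_def p_def)
      have "connected (\<psi> ` S \<union> C)"
        using conS CS(2) uS u by (intro connected_Un) auto
      moreover have "\<psi> ` S \<union> C \<subseteq> D - G"
      proof -
        have "\<psi> x \<notin> G" if "x \<in> S" for x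
          using GB[of "\<psi> x"] Sfar[OF that] S1 that phi_psi[of x] by force
        then have "\<psi> ` S \<subseteq> D - G" using S1 psi_in by auto
        moreover have "C \<subseteq> D - G" using CS GS by (force simp: T_def)
        ultimately show ?thesis by blast
      qed
      moreover have "z \<in> \<psi> ` S \<union> C" "\<psi> 0 \<in> \<psi> ` S \<union> C" using z by (auto simp: S_def)
      ultimately show False using G(2) unfolding connected_component_def by blast
    qed
    then show "\<exists>w. \<phi> ` C \<subseteq> cball w B" by blast
  qed
qed

end

section \<open>Boundary values\<close>

lemma dist_closure_le:
  fixes S :: "'a::metric_space set"
  assumes "\<And>x y. x \<in> S \<Longrightarrow> y \<in> S \<Longrightarrow> dist x y \<le> e" "a \<in> closure S" "b \<in> closure S"
  shows "dist a b \<le> e"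
proof -
  have 1: "dist x b \<le> e" if "x \<in> S" for x
  proof -
    have "closure S \<subseteq> cball x e" by (rule closure_minimal) (use assms(1) that in auto)
    then show ?thesis using assms(3) by auto
  qed
  have "closure S \<subseteq> cball b e" by (rule closure_minimal) (use 1 in \<open>auto simp: dist_commute\<close>)
  then show ?thesis using assms(2) by (auto simp: dist_commute)
qed

locale jordan_conformal = conformal_disk +
  assumes jordan: "jordan_domain D"
begin

lemma frontier_notin: "\<zeta> \<in> frontier D \<Longrightarrow> \<zeta> \<notin> D"
  using open_D frontier_disjoint_eq by fastforce

lemma at_frontier_nontrivial: "\<zeta> \<in> frontier D \<Longrightarrow> at \<zeta> within D \<noteq> bot"
  using frontier_notin[of \<zeta>]
  by (auto simp: trivial_limit_within islimpt_in_closure frontier_def Diff_triv)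

lemma small_oscillation_boundary_comp:
  assumes "\<zeta> \<in> frontier D" "\<epsilon> > 0"
  obtains r where "r > 0" "\<And>x y. x \<in> boundary_comp D \<zeta> r \<Longrightarrow> y \<in> boundary_comp D \<zeta> r \<Longrightarrow> dist (\<phi> x) (\<phi> y) \<le> \<epsilon>"
proof -
  define B where "B = min (\<epsilon> / 2) (1 / 2)"
  define m where "m = norm (\<zeta> - \<psi> 0)"
  have B: "0 < B" "B < 1" "2 * B \<le> \<epsilon>" using assms(2) by (auto simp: B_def)
  have "\<psi> 0 \<in> D" by (simp add: psi_in)
  then have m: "m > 0" using frontier_notin[OF assms(1)] by (auto simp: m_def)
  have "0 \<le> 2 * pi\<^sup>2" by simp
  then obtain r1 where r1: "0 < r1" and "r1 < m" and ln: "2 * pi\<^sup>2 < B\<^sup>2 * ln (m / r1)"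
    using inner_radius_exists[OF m B(1)] by metis
  obtain r where r: "r1 < r" "\<And>C. C \<in> components (ball \<zeta> r \<inter> D) \<Longrightarrow> \<exists>w. \<phi> ` C \<subseteq> cball w B"
    using crosscut_estimate[OF frontier_notin[OF assms(1)] r1 _ B(1,2)] \<open>r1 < m\<close> ln unfolding m_def by metis
  then have r0: "r > 0" using r1 by simp
  obtain w where w: "\<phi> ` boundary_comp D \<zeta> r \<subseteq> cball w B"
    using r(2) boundary_comp_properties(1)[OF jordan assms(1) r0] by blast
  have "dist (\<phi> x) (\<phi> y) \<le> \<epsilon>" if xy: "x \<in> boundary_comp D \<zeta> r" "y \<in> boundary_comp D \<zeta> r" for x y
  proof -
    have "dist w (\<phi> x) \<le> B" "dist w (\<phi> y) \<le> B" using w xy by auto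
    then show ?thesis using dist_triangle3[of "\<phi> x" "\<phi> y" w] B by linarith
  qed
  then show thesis using that r0 by blast
qed

text \<open>
  The components \<open>C(D; \<zeta>, r)\<close> contain all points of \<^term>\<open>D\<close> near \<^term>\<open>\<zeta>\<close>, and their images have arbitrarily small
  diameter; so \<^term>\<open>\<phi>\<close> satisfies the Cauchy criterion at \<^term>\<open>\<zeta>\<close>.
\<close>

lemma limit_exists:
  assumes "\<zeta> \<in> frontier D"
  shows "\<exists>w. (\<phi> \<longlongrightarrow> w) (at \<zeta> within D)"
proof -
  have osc: "\<exists>\<delta>>0. \<forall>x y. x \<in> D \<inter> ball \<zeta> \<delta> \<longrightarrow> y \<in> D \<inter> ball \<zeta> \<delta> \<longrightarrow> dist (\<phi> x) (\<phi> y) \<le> \<epsilon>"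
    if pos: "\<epsilon> > 0" for \<epsilon>
  proof -
    obtain r where r: "r > 0" "\<And>x y. x \<in> boundary_comp D \<zeta> r \<Longrightarrow> y \<in> boundary_comp D \<zeta> r \<Longrightarrow> dist (\<phi> x) (\<phi> y) \<le> \<epsilon>"
      using small_oscillation_boundary_comp[OF assms pos] by metis
    show ?thesis using boundary_comp_unique(2)[OF jordan assms r(1)] r(2) by (meson subsetD)
  qed
  have "\<zeta> \<in> closure D" using assms by (simp add: frontier_def)
  then obtain z where z: "\<And>n. z n \<in> D" "z \<longlonglongrightarrow> \<zeta>" unfolding closure_sequential by blast
  have ev: "eventually (\<lambda>n. z n \<in> D \<inter> ball \<zeta> \<delta>) sequentially" if "\<delta> > 0" for \<delta>
    using tendstoD[OF z(2) that] z(1) by (auto simp: dist_commute elim: eventually_mono)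
  have "Cauchy (\<lambda>n. \<phi> (z n))"
  proof (rule metric_CauchyI)
    fix e :: real assume "e > 0"
    then obtain \<delta> where "\<delta> > 0" and \<delta>: "\<And>x y. x \<in> D \<inter> ball \<zeta> \<delta> \<Longrightarrow> y \<in> D \<inter> ball \<zeta> \<delta> \<Longrightarrow> dist (\<phi> x) (\<phi> y) \<le> e / 2"
      using osc[of "e / 2"] by auto
    obtain N where N: "\<And>n. n \<ge> N \<Longrightarrow> z n \<in> D \<inter> ball \<zeta> \<delta>"
      using ev[OF \<open>\<delta> > 0\<close>] unfolding eventually_sequentially by blast
    have "dist (\<phi> (z m)) (\<phi> (z n)) < e" if "m \<ge> N" "n \<ge> N" for m n
      using \<delta>[OF N[OF that(1)] N[OF that(2)]] \<open>e > 0\<close> by simp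
    then show "\<exists>N. \<forall>m\<ge>N. \<forall>n\<ge>N. dist (\<phi> (z m)) (\<phi> (z n)) < e" by blast
  qed
  then obtain w where w: "(\<lambda>n. \<phi> (z n)) \<longlonglongrightarrow> w" using Cauchy_convergent convergent_def by blast
  have "(\<phi> \<longlongrightarrow> w) (at \<zeta> within D)"
    unfolding Lim_within
  proof (intro allI impI)
    fix e :: real assume "e > 0"
    then obtain \<delta> where "\<delta> > 0" and \<delta>: "\<And>x y. x \<in> D \<inter> ball \<zeta> \<delta> \<Longrightarrow> y \<in> D \<inter> ball \<zeta> \<delta> \<Longrightarrow> dist (\<phi> x) (\<phi> y) \<le> e / 2"
      using osc[of "e / 2"] by auto
    have "dist (\<phi> x) w < e" if x: "x \<in> D" "dist x \<zeta> < \<delta>" for x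
    proof -
      have "eventually (\<lambda>n. \<phi> (z n) \<in> cball (\<phi> x) (e / 2)) sequentially"
        using ev[OF \<open>\<delta> > 0\<close>]
      proof eventually_elim
        case (elim n)
        have "dist (\<phi> x) (\<phi> (z n)) \<le> e / 2"
          by (rule \<delta>) (use x elim in \<open>auto simp: dist_commute\<close>)
        then show ?case by simp
      qed
      then have "w \<in> cball (\<phi> x) (e / 2)"
        by (rule Lim_in_closed_set[OF closed_cball _ _ w]) simp
      then show ?thesis using \<open>e > 0\<close> by simp
    qed
    then show "\<exists>d>0. \<forall>x\<in>D. 0 < dist x \<zeta> \<and> dist x \<zeta> < d \<longrightarrow> dist (\<phi> x) w < e"
      using \<open>\<delta> > 0\<close> by blast
  qed
  then show ?thesis by blast
qed

abbreviation "ext \<equiv> boundary_ext \<phi> D"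

text \<open>
  The limit lies in every \<open>closure (\<phi> ` C(D; \<zeta>, r))\<close>, and these sets have arbitrarily small diameter, so it is the
  unique point of their intersection.
\<close>

lemma ext_limit:
  assumes "\<zeta> \<in> frontier D"
  shows "(\<phi> \<longlongrightarrow> ext \<zeta>) (at \<zeta> within D)"
    and ext_in_closure_image: "\<And>r. r > 0 \<Longrightarrow> ext \<zeta> \<in> closure (\<phi> ` boundary_comp D \<zeta> r)"
proof -
  obtain w where w: "(\<phi> \<longlongrightarrow> w) (at \<zeta> within D)" using limit_exists[OF assms] by blast
  have wcl: "w \<in> closure (\<phi> ` boundary_comp D \<zeta> r)" if r: "r > 0" for r
  proof -
    obtain \<delta> where \<delta>: "\<delta> > 0" "D \<inter> ball \<zeta> \<delta> \<subseteq> boundary_comp D \<zeta> r"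
      using boundary_comp_unique(2)[OF jordan assms r] by blast
    have "eventually (\<lambda>x. x \<in> D \<inter> ball \<zeta> \<delta>) (at \<zeta> within D)"
      using \<delta>(1) unfolding eventually_at by (intro exI[of _ \<delta>]) (auto simp: dist_commute)
    then have "eventually (\<lambda>x. \<phi> x \<in> closure (\<phi> ` boundary_comp D \<zeta> r)) (at \<zeta> within D)"
      by eventually_elim (use \<delta>(2) closure_subset in blast)
    then show ?thesis
      by (rule Lim_in_closed_set[OF closed_closure _ at_frontier_nontrivial[OF assms] w])
  qed
  have uniq: "w' = w" if w': "w' \<in> (\<Inter>r\<in>{0<..}. closure (\<phi> ` boundary_comp D \<zeta> r))" for w'
  proof -
    have "dist w' w \<le> e" if pos: "e > 0" for e
    proof -
      obtain r where r: "r > 0" "\<And>x y. x \<in> boundary_comp D \<zeta> r \<Longrightarrow> y \<in> boundary_comp D \<zeta> r \<Longrightarrow> dist (\<phi> x) (\<phi> y) \<le> e"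
        using small_oscillation_boundary_comp[OF assms pos] by metis
      show ?thesis
        by (rule dist_closure_le[of "\<phi> ` boundary_comp D \<zeta> r"]) (use r w' wcl in auto)
    qed
    then show ?thesis by (metis dist_le_zero_iff dense_ge)
  qed
  have "(THE w. w \<in> (\<Inter>r\<in>{0<..}. closure (\<phi> ` boundary_comp D \<zeta> r))) = w"
    by (rule the_equality) (use wcl uniq in auto)
  then have "ext \<zeta> = w" using assms by (simp add: boundary_ext_def)
  then show "(\<phi> \<longlongrightarrow> ext \<zeta>) (at \<zeta> within D)" "\<And>r. r > 0 \<Longrightarrow> ext \<zeta> \<in> closure (\<phi> ` boundary_comp D \<zeta> r)"
    using w wcl by auto
qed

lemma ext_interior: "z \<in> D \<Longrightarrow> ext z = \<phi> z"
  using frontier_notin[of z] by (auto simp: boundary_ext_def)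

lemma norm_ext_frontier:
  assumes "\<zeta> \<in> frontier D"
  shows "norm (ext \<zeta>) = 1"
proof -
  have "eventually (\<lambda>z. z \<in> D) (at \<zeta> within D)" by (auto simp: eventually_at_filter)
  then have "eventually (\<lambda>z. \<phi> z \<in> cball 0 1) (at \<zeta> within D)"
    by eventually_elim (use phi_in in force)
  then have "ext \<zeta> \<in> cball 0 1"
    by (rule Lim_in_closed_set[OF closed_cball _ at_frontier_nontrivial[OF assms] ext_limit(1)[OF assms]])
  moreover have "\<not> norm (ext \<zeta>) < 1"
  proof
    assume "norm (ext \<zeta>) < 1"
    then have w: "ext \<zeta> \<in> ball 0 1" by simp
    then have "isCont \<psi> (ext \<zeta>)"
      using hol_psi holomorphic_on_imp_continuous_on continuous_on_eq_continuous_at[OF open_ball] by blast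
    then have "((\<lambda>z. \<psi> (\<phi> z)) \<longlongrightarrow> \<psi> (ext \<zeta>)) (at \<zeta> within D)"
      using ext_limit(1)[OF assms] isCont_tendsto_compose by blast
    moreover have "eventually (\<lambda>z. \<psi> (\<phi> z) = z) (at \<zeta> within D)"
      using psi_phi by (auto simp: eventually_at_filter)
    ultimately have "((\<lambda>z. z) \<longlongrightarrow> \<psi> (ext \<zeta>)) (at \<zeta> within D)"
      by (rule Lim_transform_eventually)
    then have "\<zeta> = \<psi> (ext \<zeta>)"
      using tendsto_unique[OF at_frontier_nontrivial[OF assms]] tendsto_ident_at by blast
    then show False using psi_in[OF w] frontier_notin[OF assms] by simp
  qed
  ultimately show ?thesis by simp
qed

section \<open>The quantitative estimate\<close>

text \<open>
  For every \<open>l\<close> the point \<open>w = 0\<close> competes in the infimum, and the exponent is largest as \<open>l\<close> tends to 0.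
  This replaces the supremum by an explicit quantity.
\<close>

lemma closeness_bound_le:
  assumes "\<epsilon> > 0"
  shows "closeness_bound \<phi> D \<zeta> \<epsilon> \<le> norm (\<zeta> - \<psi> 0) * exp (- (8 * pi\<^sup>2 / \<epsilon>\<^sup>2))"
  unfolding closeness_bound_def
proof (rule cSUP_least)
  show "{0<..<\<epsilon>} \<noteq> {}" using assms by simp
  fix l assume l: "l \<in> {0<..<\<epsilon>}"
  let ?W = "{w. norm w < 1 \<and> norm w \<le> sqrt ((1 - l)\<^sup>2 + (\<epsilon>\<^sup>2 - l\<^sup>2) / 4)}"
  have le: "l\<^sup>2 < \<epsilon>\<^sup>2" using l by (simp add: power_strict_mono)
  have "(INF w\<in>?W. norm (\<zeta> - inv_into D \<phi> w)) \<le> norm (\<zeta> - inv_into D \<phi> 0)"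
  proof (rule cINF_lower)
    show "bdd_below ((\<lambda>w. norm (\<zeta> - inv_into D \<phi> w)) ` ?W)" by (rule bdd_belowI2[of _ 0]) simp
    show "0 \<in> ?W" using le by simp
  qed
  moreover have "8 * pi\<^sup>2 / (l\<^sup>2 - \<epsilon>\<^sup>2) \<le> - (8 * pi\<^sup>2 / \<epsilon>\<^sup>2)"
  proof -
    have "8 * pi\<^sup>2 / \<epsilon>\<^sup>2 \<le> 8 * pi\<^sup>2 / (\<epsilon>\<^sup>2 - l\<^sup>2)" using le assms by (intro divide_left_mono mult_pos_pos) auto
    moreover have "8 * pi\<^sup>2 / (l\<^sup>2 - \<epsilon>\<^sup>2) = - (8 * pi\<^sup>2 / (\<epsilon>\<^sup>2 - l\<^sup>2))"
      by (metis minus_diff_eq minus_divide_right)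
    ultimately show ?thesis by simp
  qed
  ultimately have "exp (8 * pi\<^sup>2 / (l\<^sup>2 - \<epsilon>\<^sup>2)) * (INF w\<in>?W. norm (\<zeta> - inv_into D \<phi> w))
      \<le> exp (- (8 * pi\<^sup>2 / \<epsilon>\<^sup>2)) * norm (\<zeta> - inv_into D \<phi> 0)"
    using le by (intro mult_mono cINF_greatest) (auto intro: exI[of _ 0])
  then show "exp (8 * pi\<^sup>2 / (l\<^sup>2 - \<epsilon>\<^sup>2)) * (INF w\<in>?W. norm (\<zeta> - inv_into D \<phi> w))
      \<le> norm (\<zeta> - \<psi> 0) * exp (- (8 * pi\<^sup>2 / \<epsilon>\<^sup>2))"
    by (simp add: \<psi>_def mult.commute)
qed

text \<open>
  With \<open>r1 = 1 / 2 ^ k + 1 / 2 ^ g k\<close> and \<open>m = \<bar>\<zeta> - \<psi> 0\<bar>\<close>, the hypothesis gives \<open>ln (m / r1) > 8 \<pi>\<^sup>2 / \<epsilon>\<^sup>2\<close>. This is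
  what the crosscut estimate requires for some \<open>B < \<epsilon> / 2\<close>, and then \<open>\<phi> z\<close> and the boundary
  value lie in one disk of radius \<open>B\<close>. For \<open>\<epsilon> \<ge> 2\<close> there is nothing to prove, since the image is the unit
  disk; for smaller \<open>\<epsilon>\<close> the requirement \<open>B < 1\<close> is automatic.
\<close>

lemma quantitative_boundary_continuity:
  assumes \<zeta>: "\<zeta> \<in> frontier D" and g: "local_connectivity_modulus (frontier D) g" and \<epsilon>: "\<epsilon> > 0"
    and z: "z \<in> D" "norm (z - \<zeta>) < 1 / 2 ^ g k"
    and close: "1 / 2 ^ k + 1 / 2 ^ g k < closeness_bound \<phi> D \<zeta> \<epsilon>"
  shows "norm (\<phi> z - ext \<zeta>) < \<epsilon>"
proof (cases "\<epsilon> \<ge> 2")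
  case True
  have "norm (\<phi> z) < 1" using phi_in[OF z(1)] by simp
  then show ?thesis using norm_triangle_ineq4[of "\<phi> z" "ext \<zeta>"] norm_ext_frontier[OF \<zeta>] True by linarith
next
  case False
  define r1 :: real where "r1 = 1 / 2 ^ k + 1 / 2 ^ g k"
  define m where "m = norm (\<zeta> - \<psi> 0)"
  define L where "L = ln (m / r1)"
  have r1: "0 < r1" by (auto simp: r1_def intro!: add_pos_pos)
  have r1m: "r1 < m * exp (- (8 * pi\<^sup>2 / \<epsilon>\<^sup>2))"
    using close closeness_bound_le[OF \<epsilon>, of \<zeta>] unfolding r1_def m_def by linarith
  have m0: "m > 0"
  proof (rule ccontr)
    assume "\<not> m > 0"
    then have "m = 0" by (simp add: m_def)
    then show False using r1m r1 by simp
  qed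
  have "exp (8 * pi\<^sup>2 / \<epsilon>\<^sup>2) < m / r1"
    using r1m r1 by (simp add: exp_minus field_simps)
  then have L: "8 * pi\<^sup>2 / \<epsilon>\<^sup>2 < L" using m0 r1 unfolding L_def
    by (metis divide_pos_pos exp_gt_zero ln_exp ln_less_cancel_iff)
  have L0: "L > 0" using L \<epsilon> by (smt (verit) divide_nonneg_nonneg zero_le_power2)
  have "2 * pi\<^sup>2 / L < (\<epsilon> / 2)\<^sup>2"
    using L L0 \<epsilon> by (simp add: field_simps power2_eq_square)
  then have "sqrt (2 * pi\<^sup>2 / L) < \<epsilon> / 2"
    using \<epsilon> by (intro real_less_lsqrt) auto
  then obtain B where B: "sqrt (2 * pi\<^sup>2 / L) < B" "B < \<epsilon> / 2" using dense by blast
  have "0 \<le> sqrt (2 * pi\<^sup>2 / L)" using L0 by simp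
  then have B0: "0 < B" "B < 1" using B False by linarith+
  have "2 * pi\<^sup>2 / L < B\<^sup>2" using B(1) B0 by (metis real_less_rsqrt real_sqrt_less_iff real_sqrt_unique less_eq_real_def)
  then have ln: "2 * pi\<^sup>2 < B\<^sup>2 * ln (m / r1)" using L0 by (simp add: L_def[symmetric] field_simps)
  have "r1 < m" using r1m m0 by (smt (verit) exp_le_one_iff mult_left_le divide_nonneg_nonneg zero_le_power2)
  then obtain r where r: "r1 < r" "\<And>C. C \<in> components (ball \<zeta> r \<inter> D) \<Longrightarrow> \<exists>w. \<phi> ` C \<subseteq> cball w B"
    using crosscut_estimate[OF frontier_notin[OF \<zeta>] r1 _ B0] ln unfolding m_def by metis
  have r0: "r > 0" using r r1 by simp
  obtain w where w: "\<phi> ` boundary_comp D \<zeta> r \<subseteq> cball w B"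
    using r(2) boundary_comp_properties(1)[OF jordan \<zeta> r0] by blast
  have "z \<in> boundary_comp D \<zeta> r"
    using modulus_imp_in_boundary_comp[OF jordan \<zeta> g z] r(1) by (simp add: r1_def)
  then have "dist w (\<phi> z) \<le> B" using w by auto
  moreover have "ext \<zeta> \<in> cball w B"
    using ext_in_closure_image[OF \<zeta> r0] closure_minimal[OF w closed_cball] by blast
  ultimately have "dist (\<phi> z) (ext \<zeta>) \<le> 2 * B"
    using dist_triangle3[of "\<phi> z" "ext \<zeta>" w] by simp
  then show ?thesis using B by (simp add: dist_norm)
qed

section \<open>The extension is a homeomorphism\<close>

lemma continuous_on_ext: "continuous_on (closure D) ext"
  unfolding continuous_on_eq_continuous_within
proof
  fix x assume x: "x \<in> closure D"
  show "continuous (at x within closure D) ext"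
  proof (cases "x \<in> D")
    case True
    have "isCont \<phi> x"
      using True hol holomorphic_on_imp_continuous_on continuous_on_eq_continuous_at[OF open_D] by blast
    moreover have "eventually (\<lambda>z. ext z = \<phi> z) (nhds x)"
      using open_D True ext_interior unfolding eventually_nhds by blast
    ultimately have "isCont ext x" by (simp add: isCont_cong)
    then show ?thesis by (rule continuous_at_imp_continuous_within)
  next
    case False
    then have xf: "x \<in> frontier D" using x open_D by (simp add: frontier_def interior_open)
    show ?thesis unfolding continuous_within_eps_delta
    proof (intro allI impI)
      fix e :: real assume e: "e > 0"
      then obtain d where "d > 0" and d: "\<And>y. y \<in> D \<Longrightarrow> 0 < dist y x \<Longrightarrow> dist y x < d \<Longrightarrow> dist (\<phi> y) (ext x) < e / 2"
        using ext_limit(1)[OF xf] unfolding Lim_within by (meson half_gt_zero)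
      have "dist (ext y) (ext x) < e" if y: "y \<in> closure D" "dist y x < d" for y
      proof (cases "y \<in> D")
        case True
        then have "dist (\<phi> y) (ext x) < e / 2" using d[of y] y False by (metis zero_less_dist_iff)
        then show ?thesis using e True by (simp add: ext_interior)
      next
        case False
        then have yf: "y \<in> frontier D" using y open_D by (simp add: frontier_def interior_open)
        have "eventually (\<lambda>z. z \<in> D \<and> dist z y < d - dist y x) (at y within D)"
          using y(2) unfolding eventually_at by (intro exI[of _ "d - dist y x"]) auto
        then have "eventually (\<lambda>z. \<phi> z \<in> cball (ext x) (e / 2)) (at y within D)"
        proof eventually_elim
          case (elim z)
          then have "dist z x < d" using dist_triangle[of z x y] by simp
          moreover have "0 < dist z x" using elim \<open>x \<notin> D\<close> by auto
          ultimately show ?case using d[of z] elim by (simp add: dist_commute)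
        qed
        then have "ext y \<in> cball (ext x) (e / 2)"
          by (rule Lim_in_closed_set[OF closed_cball _ at_frontier_nontrivial[OF yf] ext_limit(1)[OF yf]])
        then show ?thesis using e by (simp add: dist_commute)
      qed
      then show "\<exists>d>0. \<forall>x'\<in>closure D. dist x' x < d \<longrightarrow> dist (ext x') (ext x) < e"
        using \<open>d > 0\<close> by blast
    qed
  qed
qed


text \<open>
  On the circle around \<^term>\<open>w0\<close>, parametrised by \<open>w0 (1 - \<rho> e\<^sup>i\<^sup>t)\<close> with \<open>\<bar>t\<bar> \<le> \<pi>\<close>, the unit disk cuts out the
  interval \<open>\<bar>t\<bar> < arccos (\<rho> / 2)\<close>.
\<close>

lemma connected_circle_arc_in_disk:
  fixes w0 :: complex
  assumes "norm w0 = 1" "0 < \<rho>" "\<rho> < 1"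
  shows "connected (sphere w0 \<rho> \<inter> ball 0 1)"
proof -
  define \<tau> where "\<tau> = arccos (\<rho> / 2)"
  have \<tau>: "cos \<tau> = \<rho> / 2" "0 \<le> \<tau>" "\<tau> \<le> pi"
    using assms by (auto simp: \<tau>_def arccos_lbound arccos_ubound)
  have w0: "w0 \<noteq> 0" using assms by auto
  let ?f = "\<lambda>t. w0 * (1 - of_real \<rho> * cis t)"
  have norm_f: "(norm (?f t))\<^sup>2 = 1 - 2 * \<rho> * cos t + \<rho>\<^sup>2" for t
  proof -
    have "(norm (?f t))\<^sup>2 = (1 - \<rho> * cos t)\<^sup>2 + (\<rho> * sin t)\<^sup>2"
      using assms(1) by (simp add: norm_mult cmod_power2)
    also have "\<dots> = 1 - 2 * \<rho> * cos t + \<rho>\<^sup>2 * ((cos t)\<^sup>2 + (sin t)\<^sup>2)"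
      by algebra
    finally show ?thesis by simp
  qed
  have in_ball: "norm (?f t) < 1 \<longleftrightarrow> \<rho> / 2 < cos t" for t
  proof -
    have "norm (?f t) < 1 \<longleftrightarrow> (norm (?f t))\<^sup>2 < 1"
      using abs_square_less_1[of "norm (?f t)"] by simp
    also have "\<dots> \<longleftrightarrow> \<rho> * \<rho> < \<rho> * (2 * cos t)" unfolding norm_f by (simp add: power2_eq_square algebra_simps)
    also have "\<dots> \<longleftrightarrow> \<rho> / 2 < cos t" using assms(2) by (auto simp: mult.commute)
    finally show ?thesis .
  qed
  have cos_iff: "\<rho> / 2 < cos t \<longleftrightarrow> \<bar>t\<bar> < \<tau>" if "\<bar>t\<bar> \<le> pi" for t
    using cos_mono_less_eq[of \<tau> "\<bar>t\<bar>"] that \<tau> by (simp add: cos_abs_real)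
  have "sphere w0 \<rho> \<inter> ball 0 1 = ?f ` {-\<tau><..<\<tau>}"
  proof (intro equalityI subsetI)
    fix z assume z: "z \<in> sphere w0 \<rho> \<inter> ball 0 1"
    define v where "v = (w0 - z) / (of_real \<rho> * w0)"
    have "norm v = 1" using z assms by (simp add: v_def norm_divide norm_mult dist_norm)
    then have "v \<noteq> 0" by force
    then have v: "v = cis (Arg v)" using Arg_eq[of v] \<open>norm v = 1\<close> by (simp add: cis_conv_exp)
    have "of_real \<rho> * v * w0 = w0 - z" using w0 assms by (simp add: v_def)
    then have zf: "z = ?f (Arg v)" using v by (simp add: algebra_simps)
    have b: "\<bar>Arg v\<bar> \<le> pi" using Arg_bounded[of v] by auto
    have "norm (?f (Arg v)) < 1" using z unfolding zf by simp
    then have "Arg v \<in> {-\<tau><..<\<tau>}" unfolding in_ball cos_iff[OF b] by auto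
    then show "z \<in> ?f ` {-\<tau><..<\<tau>}" using zf by blast
  next
    fix z assume "z \<in> ?f ` {-\<tau><..<\<tau>}"
    then obtain t where "t \<in> {-\<tau><..<\<tau>}" "z = ?f t" by (rule imageE)
    then have t: "\<bar>t\<bar> < \<tau>" "z = ?f t" by auto
    then have "norm z < 1" using in_ball[of t] cos_iff[of t] \<tau>(3) by simp
    moreover have "w0 - z = of_real \<rho> * cis t * w0" by (simp add: t algebra_simps)
    then have "dist w0 z = \<rho>" using assms by (simp add: dist_norm norm_mult)
    ultimately show "z \<in> sphere w0 \<rho> \<inter> ball 0 1" by simp
  qed
  moreover have "connected (?f ` {-\<tau><..<\<tau>})"
    by (intro connected_continuous_image continuous_intros) auto
  ultimately show ?thesis by simp
qed

lemma small_crosscut_psi: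
  assumes "norm w0 = 1" "0 < R" "0 < B"
  obtains \<rho> where "0 < \<rho>" "\<rho> < R"
    "\<And>K x y. connected K \<Longrightarrow> K \<subseteq> sphere w0 \<rho> \<inter> ball 0 1 \<Longrightarrow> x \<in> K \<Longrightarrow> y \<in> K \<Longrightarrow> dist (\<psi> x) (\<psi> y) \<le> B"
proof -
  obtain M where M: "D \<subseteq> ball 0 M"
    using bounded_jordan_domain[OF jordan] bounded_subset_ballD by blast
  then have im: "\<psi> ` ball 0 1 \<subseteq> ball 0 M" by (simp add: image_psi)
  have "0 \<le> 2 * pi\<^sup>2 * M\<^sup>2" by simp
  then obtain r1 where r1: "0 < r1" "r1 < R" and ln: "2 * pi\<^sup>2 * M\<^sup>2 < B\<^sup>2 * ln (R / r1)"
    using inner_radius_exists[OF assms(2,3)] by metis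
  show thesis
  proof (rule length_area[OF open_ball hol_psi inj_psi im r1 assms(3) ln, where c=w0])
    fix r assume "r1 < r" "r < R"
      "\<And>K x y. connected K \<Longrightarrow> K \<subseteq> sphere w0 r \<inter> ball 0 1 \<Longrightarrow> x \<in> K \<Longrightarrow> y \<in> K \<Longrightarrow> dist (\<psi> x) (\<psi> y) \<le> B"
    then show thesis using that[of r] r1 by auto
  qed
qed

text \<open>
  Small circles around \<^term>\<open>w0\<close> have images under \<open>\<psi>\<close> of small diameter in the bounded domain, so
  a sequence of them shrinks to a point \<^term>\<open>p\<close>. That point is not in \<^term>\<open>D\<close>, since \<^term>\<open>\<phi>\<close> would map it to
  \<^term>\<open>w0\<close>, which is on the unit circle.
\<close>

lemma small_crosscuts_cluster_at_frontier:
  assumes "norm w0 = 1"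
  obtains p where "p \<in> frontier D"
    "\<And>e. e > 0 \<Longrightarrow> \<exists>\<rho>. 0 < \<rho> \<and> \<rho> < 1 \<and> closure (\<psi> ` (sphere w0 \<rho> \<inter> ball 0 1)) \<subseteq> ball p e"
proof -
  have "\<exists>\<rho>. 0 < \<rho> \<and> \<rho> < 1 / (real n + 2) \<and> (\<forall>x y. x \<in> sphere w0 \<rho> \<inter> ball 0 1 \<longrightarrow> y \<in> sphere w0 \<rho> \<inter> ball 0 1
      \<longrightarrow> dist (\<psi> x) (\<psi> y) \<le> 1 / (real n + 1))" for n
  proof -
    have "0 < 1 / (real n + 2)" "0 < 1 / (real n + 1)" by auto
    then obtain \<rho> where \<rho>: "0 < \<rho>" "\<rho> < 1 / (real n + 2)"
      "\<And>K x y. connected K \<Longrightarrow> K \<subseteq> sphere w0 \<rho> \<inter> ball 0 1 \<Longrightarrow> x \<in> K \<Longrightarrow> y \<in> K \<Longrightarrow> dist (\<psi> x) (\<psi> y) \<le> 1 / (real n + 1)"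
      using small_crosscut_psi[OF assms] by metis
    have "1 / (real n + 2) < 1" by simp
    then have "\<rho> < 1" using \<rho>(2) by linarith
    show ?thesis
      using \<rho>(1,2) \<rho>(3)[OF connected_circle_arc_in_disk[OF assms \<rho>(1) \<open>\<rho> < 1\<close>] order_refl] by blast
  qed
  then obtain \<rho> where \<rho>: "\<And>n. 0 < \<rho> n" "\<And>n. \<rho> n < 1 / (real n + 2)"
    "\<And>n x y. x \<in> sphere w0 (\<rho> n) \<inter> ball 0 1 \<Longrightarrow> y \<in> sphere w0 (\<rho> n) \<inter> ball 0 1 \<Longrightarrow> dist (\<psi> x) (\<psi> y) \<le> 1 / (real n + 1)"
    by metis
  have \<rho>1: "\<rho> n < 1" for n
  proof -
    have "1 / (real n + 2) < 1" by simp
    then show ?thesis using \<rho>(2)[of n] by linarith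
  qed
  have \<rho>0: "\<rho> \<longlonglongrightarrow> 0"
  proof (rule tendsto_sandwich[of "\<lambda>_. 0" _ _ "\<lambda>n. 1 / (real n + 2)"])
    show "(\<lambda>n. 1 / (real n + 2)) \<longlonglongrightarrow> 0" by real_asymp
  qed (auto intro!: always_eventually less_imp_le \<rho>(1,2))
  define a where "a n = of_real (1 - \<rho> n) * w0" for n
  have a: "a n \<in> sphere w0 (\<rho> n) \<inter> ball 0 1" for n
  proof -
    have "norm (a n) = 1 - \<rho> n" using assms \<rho>1[of n] by (simp add: a_def norm_mult del: of_real_diff)
    moreover have "w0 - a n = of_real (\<rho> n) * w0" by (simp add: a_def algebra_simps)
    then have "dist w0 (a n) = \<rho> n" using assms \<rho>(1)[of n] by (simp add: dist_norm norm_mult)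
    ultimately show ?thesis using \<rho>(1)[of n] by simp
  qed
  have alim: "a \<longlonglongrightarrow> w0"
  proof -
    have "(\<lambda>n. of_real (1 - \<rho> n) * w0) \<longlonglongrightarrow> of_real (1 - 0) * w0"
      by (intro tendsto_intros \<rho>0)
    then show ?thesis by (simp add: a_def[abs_def])
  qed
  have pD: "\<psi> (a n) \<in> D" for n using a[of n] psi_in by blast
  have "compact (closure D)" using bounded_jordan_domain[OF jordan] by (simp add: compact_closure)
  moreover have "\<forall>n. \<psi> (a n) \<in> closure D" using pD closure_subset by blast
  ultimately obtain p s where p: "p \<in> closure D" "strict_mono (s :: nat \<Rightarrow> nat)" "((\<lambda>n. \<psi> (a n)) \<circ> s) \<longlonglongrightarrow> p"
    by (rule seq_compactE[OF compact_imp_seq_compact])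
  have "p \<notin> D"
  proof
    assume "p \<in> D"
    then have "isCont \<phi> p"
      using hol holomorphic_on_imp_continuous_on continuous_on_eq_continuous_at[OF open_D] by blast
    then have "(\<lambda>n. \<phi> (((\<lambda>n. \<psi> (a n)) \<circ> s) n)) \<longlonglongrightarrow> \<phi> p" using p(3) by (rule isCont_tendsto_compose)
    moreover have "\<phi> (((\<lambda>n. \<psi> (a n)) \<circ> s) n) = (a \<circ> s) n" for n
      using phi_psi a by simp
    moreover have "(a \<circ> s) \<longlonglongrightarrow> w0" by (rule LIMSEQ_subseq_LIMSEQ[OF alim p(2)])
    ultimately have "\<phi> p = w0" by (metis (no_types, lifting) LIMSEQ_unique comp_def tendsto_cong ext)
    then show False using phi_in[OF \<open>p \<in> D\<close>] assms by simp
  qed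
  then have pf: "p \<in> frontier D" using p(1) open_D by (simp add: frontier_def interior_open)
  show thesis
  proof (rule that[OF pf])
    fix e :: real assume e: "e > 0"
    have "eventually (\<lambda>n. dist (((\<lambda>n. \<psi> (a n)) \<circ> s) n) p < e / 3) sequentially"
      using tendstoD[OF p(3), of "e / 3"] e by simp
    moreover have "(\<lambda>n. 1 / (real n + 1)) \<longlonglongrightarrow> 0" by real_asymp
    then have "(\<lambda>n. 1 / (real (s n) + 1)) \<longlonglongrightarrow> 0"
      using LIMSEQ_subseq_LIMSEQ[OF _ p(2)] by (force simp: o_def)
    then have "eventually (\<lambda>n. 1 / (real (s n) + 1) < e / 3) sequentially"
      by (rule order_tendstoD(2)) (use e in simp)
    ultimately have "eventually (\<lambda>n. dist (\<psi> (a (s n))) p < e / 3 \<and> 1 / (real (s n) + 1) < e / 3) sequentially"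
      by eventually_elim simp
    then obtain n where n: "dist (\<psi> (a (s n))) p < e / 3" "1 / (real (s n) + 1) < e / 3"
      using eventually_happens'[OF sequentially_bot] by blast
    have "\<psi> ` (sphere w0 (\<rho> (s n)) \<inter> ball 0 1) \<subseteq> cball p (2 * e / 3)"
    proof
      fix y assume "y \<in> \<psi> ` (sphere w0 (\<rho> (s n)) \<inter> ball 0 1)"
      then have "dist y (\<psi> (a (s n))) \<le> 1 / (real (s n) + 1)" using \<rho>(3) a by blast
      then show "y \<in> cball p (2 * e / 3)" using dist_triangle[of y p "\<psi> (a (s n))"] n by (simp add: dist_commute)
    qed
    then have "closure (\<psi> ` (sphere w0 (\<rho> (s n)) \<inter> ball 0 1)) \<subseteq> cball p (2 * e / 3)"
      by (rule closure_minimal) simp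
    also have "\<dots> \<subseteq> ball p e" using e by auto
    finally show "\<exists>\<rho>. 0 < \<rho> \<and> \<rho> < 1 \<and> closure (\<psi> ` (sphere w0 \<rho> \<inter> ball 0 1)) \<subseteq> ball p e"
      using \<rho>(1) \<rho>1 by blast
  qed
qed

text \<open>
  The only boundary point that can be sent to \<^term>\<open>w0\<close> is the point \<^term>\<open>p\<close> to which the small crosscuts
  shrink. For another such point \<open>\<zeta>\<close>, take \<open>z\<close> near \<open>\<zeta>\<close> with \<open>\<phi> z\<close> inside a small circle around \<^term>\<open>w0\<close>,
  and let \<open>\<Gamma>\<close> be the closed image under \<open>\<psi>\<close> of the part of that circle in the disk. Both \<open>z\<close> and \<open>\<psi> 0\<close> lie away from
  \<^term>\<open>p\<close>, whereas \<open>\<Gamma>\<close> and the short boundary arc \<open>J1\<close> around \<^term>\<open>p\<close> are concentrated near \<^term>\<open>p\<close>, and \<open>\<Gamma>\<close>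
  meets the boundary only in \<open>J1\<close>. Janiszewski's theorem joins \<open>z\<close> to \<open>\<psi> 0\<close> in \<^term>\<open>D\<close> without meeting
  \<open>\<Gamma>\<close>, although the circle separates their images.
\<close>

lemma ext_frontier_unique:
  assumes "norm w0 = 1"
  obtains p where "\<And>\<zeta>. \<zeta> \<in> frontier D \<Longrightarrow> ext \<zeta> = w0 \<Longrightarrow> \<zeta> = p"
proof -
  obtain p where p: "p \<in> frontier D"
    and small: "\<And>e. e > 0 \<Longrightarrow> \<exists>\<rho>. 0 < \<rho> \<and> \<rho> < 1 \<and> closure (\<psi> ` (sphere w0 \<rho> \<inter> ball 0 1)) \<subseteq> ball p e"
    using small_crosscuts_cluster_at_frontier[OF assms] by metis
  have False if \<zeta>: "\<zeta> \<in> frontier D" "ext \<zeta> = w0" "\<zeta> \<noteq> p" for \<zeta>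
  proof -
    have psi0: "\<psi> 0 \<in> D" by (simp add: psi_in)
    \<comment> \<open>This keeps \<open>\<psi> 0\<close> and everything within \<open>\<eta>\<close> of \<open>\<zeta>\<close> out of the disk of radius \<open>\<eta>\<close> around \<open>p\<close>.\<close>
    define \<eta> where "\<eta> = min (dist p (\<psi> 0)) (dist p \<zeta> / 2)"
    have \<eta>: "\<eta> > 0" "\<eta> \<le> dist p (\<psi> 0)" "2 * \<eta> \<le> dist p \<zeta>"
      using \<zeta>(3) psi0 frontier_notin[OF p] by (auto simp: \<eta>_def)
    obtain c where c: "simple_path c" "pathfinish c = pathstart c" "D \<in> components (- path_image c)"
      using jordan by (auto simp: jordan_domain_def)
    have "p \<in> path_image c"
      using frontier_component_subset[OF _ c(3)] p c(1) by (auto simp: closed_simple_path_image)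
    then obtain J1 J2 \<delta> where J: "path_image c = J1 \<union> J2" "connected J1" "closed J1" "connected J2" "closed J2"
      "J1 \<subseteq> ball p \<eta>" "\<delta> > 0" "J2 \<inter> ball p \<delta> = {}"
      using loop_local_split[OF c(1,2) _ \<eta>(1)] by blast
    obtain \<rho> where \<rho>: "0 < \<rho>" "\<rho> < 1" "closure (\<psi> ` (sphere w0 \<rho> \<inter> ball 0 1)) \<subseteq> ball p (min \<delta> \<eta>)"
      using small[of "min \<delta> \<eta>"] J(7) \<eta>(1) by auto
    define \<Gamma> where "\<Gamma> = closure (\<psi> ` (sphere w0 \<rho> \<inter> ball 0 1))"
    have \<Gamma>: "\<Gamma> \<subseteq> ball p \<delta>" "\<Gamma> \<subseteq> ball p \<eta>" "closed \<Gamma>" using \<rho>(3) by (auto simp: \<Gamma>_def)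
    define T where "T = \<Gamma> \<union> J1"
    have "eventually (\<lambda>z. dist (\<phi> z) w0 < \<rho>) (at \<zeta> within D)"
      using tendstoD[OF ext_limit(1)[OF \<zeta>(1)] \<rho>(1)] \<zeta>(2) by simp
    moreover have "eventually (\<lambda>z. z \<in> D \<and> dist z \<zeta> < \<eta>) (at \<zeta> within D)"
      using \<eta>(1) unfolding eventually_at by blast
    ultimately have "eventually (\<lambda>z. dist (\<phi> z) w0 < \<rho> \<and> z \<in> D \<and> dist z \<zeta> < \<eta>) (at \<zeta> within D)"
      by eventually_elim simp
    then obtain z where z: "dist (\<phi> z) w0 < \<rho>" "z \<in> D" "dist z \<zeta> < \<eta>"
      using eventually_happens'[OF at_frontier_nontrivial[OF \<zeta>(1)]] by blast
    have zfar: "z \<notin> ball p \<eta>" using z(3) \<eta>(3) dist_triangle[of p \<zeta> z] by auto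
    have Tb: "T \<subseteq> ball p \<eta>" using \<Gamma> J by (auto simp: T_def)
    have "connected_component (- (path_image c \<union> T)) z (\<psi> 0)"
    proof (rule Janiszewski)
      show "compact (path_image c)" using c(1) by (simp add: compact_simple_path_image)
      show "closed T" using J \<Gamma> by (simp add: T_def closed_Un)
      have "path_image c \<inter> T = J1" using J \<Gamma> by (auto simp: T_def)
      then show "connected (path_image c \<inter> T)" using J by simp
      show "connected_component (- path_image c) z (\<psi> 0)"
        unfolding connected_component_def
        using z(2) psi0 in_components_connected[OF c(3)] in_components_subset[OF c(3)] by blast
      have "connected (- ball p \<eta>)" by (rule connected_complement_bounded_convex) auto
      moreover have "\<psi> 0 \<in> - ball p \<eta>" using \<eta>(2) by simp
      moreover have "z \<in> - ball p \<eta>" using zfar by simp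
      moreover have "- ball p \<eta> \<subseteq> - T" using Tb by blast
      ultimately show "connected_component (- T) z (\<psi> 0)" unfolding connected_component_def by blast
    qed
    then obtain X where X: "connected X" "X \<subseteq> - (path_image c \<union> T)" "z \<in> X" "\<psi> 0 \<in> X"
      by (auto simp: connected_component_def)
    have XD: "X \<subseteq> D"
      by (rule components_maximal[OF c(3) X(1)]) (use X psi0 in auto)
    have "connected (\<phi> ` X)"
      by (intro connected_continuous_image X continuous_on_subset[OF holomorphic_on_imp_continuous_on[OF hol] XD])
    moreover have "\<phi> z \<in> \<phi> ` X \<inter> ball w0 \<rho>" using X z by (simp add: dist_commute)
    moreover have "\<phi> (\<psi> 0) \<in> \<phi> ` X - ball w0 \<rho>"
      using X \<rho>(2) assms phi_psi[of 0] by (auto simp: dist_norm)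
    ultimately have "\<phi> ` X \<inter> frontier (ball w0 \<rho>) \<noteq> {}"
      by (intro connected_Int_frontier) blast+
    then have "\<phi> ` X \<inter> sphere w0 \<rho> \<noteq> {}" using \<rho>(1) by simp
    then obtain x where x: "x \<in> X" "\<phi> x \<in> sphere w0 \<rho>" by blast
    then have "\<phi> x \<in> sphere w0 \<rho> \<inter> ball 0 1" using phi_in XD by blast
    then have "x \<in> \<psi> ` (sphere w0 \<rho> \<inter> ball 0 1)" using psi_phi[of x] x XD by (metis image_eqI subsetD)
    then have "x \<in> \<Gamma>" unfolding \<Gamma>_def by (rule subsetD[OF closure_subset])
    then have "x \<in> T" by (simp add: T_def)
    then show False using X x by blast
  qed
  then show thesis using that by blast
qed

lemma homeomorphism_ext: "\<exists>\<psi>'. homeomorphism (closure D) (cball 0 1) ext \<psi>'"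
proof (rule homeomorphism_compact)
  have clD: "closure D = D \<union> frontier D" by (simp add: closure_Un_frontier)
  show comp: "compact (closure D)" using bounded_jordan_domain[OF jordan] by (simp add: compact_closure)
  show cont: "continuous_on (closure D) ext" by (rule continuous_on_ext)
  show "ext ` closure D = cball 0 1"
  proof
    have "ext x \<in> cball 0 1" if "x \<in> closure D" for x
      using that phi_in[of x] norm_ext_frontier[of x] unfolding clD by (auto simp: ext_interior)
    then show "ext ` closure D \<subseteq> cball 0 1" by blast
    have "ball 0 1 \<subseteq> ext ` closure D"
    proof
      fix w :: complex assume w: "w \<in> ball 0 1"
      then have "ext (\<psi> w) = w" using ext_interior psi_in phi_psi by simp
      moreover have "\<psi> w \<in> closure D" using psi_in[OF w] closure_subset by blast
      ultimately show "w \<in> ext ` closure D" by (metis image_eqI)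
    qed
    then have "closure (ball 0 1) \<subseteq> ext ` closure D"
      using compact_imp_closed[OF compact_continuous_image[OF cont comp]] by (rule closure_minimal)
    then show "cball 0 1 \<subseteq> ext ` closure D" by simp
  qed
  show "inj_on ext (closure D)"
  proof (rule inj_onI)
    fix x y assume xy: "x \<in> closure D" "y \<in> closure D" "ext x = ext y"
    have D: "norm (ext z) < 1" if "z \<in> D" for z using phi_in[OF that] that by (simp add: ext_interior)
    consider "x \<in> D" "y \<in> D" | "x \<in> frontier D" "y \<in> frontier D"
      using xy D norm_ext_frontier unfolding clD by (metis UnE less_irrefl)
    then show "x = y"
    proof cases
      case 1
      then show ?thesis using xy(3) inj_onD[OF inj_phi] by (simp add: ext_interior)
    next
      case 2
      then show ?thesis using ext_frontier_unique[OF norm_ext_frontier[OF 2(1)]] xy(3) by metis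
    qed
  qed
qed

end

section \<open>Boundary behaviour of conformal maps of Jordan domains\<close>

theorem theorem3p5:
  fixes \<phi> :: "complex \<Rightarrow> complex" and D :: "complex set" and \<zeta>0 :: complex
  assumes "jordan_domain D"
    and "conformal_onto_disk \<phi> D"
    and "\<zeta>0 \<in> frontier D"
  shows "(\<phi> \<longlongrightarrow> boundary_ext \<phi> D \<zeta>0) (at \<zeta>0 within D) \<and>
         (\<forall>g. local_connectivity_modulus (frontier D) g \<longrightarrow>
            (\<forall>\<epsilon>>0. \<forall>z0\<in>D. \<forall>k::nat.
               norm (z0 - \<zeta>0) < 1 / 2 ^ g k \<and>
               1 / 2 ^ k + 1 / 2 ^ g k < closeness_bound \<phi> D \<zeta>0 \<epsilon> \<longrightarrow>
               norm (\<phi> z0 - boundary_ext \<phi> D \<zeta>0) < \<epsilon>)) \<and>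
         (\<exists>\<psi>. homeomorphism (closure D) (cball 0 1) (boundary_ext \<phi> D) \<psi>)"
proof -
  interpret jordan_conformal \<phi> D
    using assms(1,2) open_jordan_domain
    by unfold_locales (auto simp: conformal_onto_disk_def)
  show ?thesis
    using ext_limit(1)[OF assms(3)] quantitative_boundary_continuity[OF assms(3)] homeomorphism_ext
    by blast
qed

end
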